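(* Let $F/\mathbb{F}_q$ be an algebraic function field of genus $g$. Let $P_1,\ldots,P_s$ be distinct places of $F$ of degrees $k_i=\deg(P_i)$ respectively, and let $G$ be a divisor of $F$ with $\mathrm{Supp}(G)\cap\{P_1,\ldots,P_s\}=\emptyset$ and $\deg(G)<\sum_{i=1}^s k_i$. For $1\le i\le s$, let $C_i$ be an $[n_i,k_i,d_i]$ linear code over $\mathbb{F}_q$ with locality at most $k_i$, and let $\pi_i$ be an $\mathbb{F}_q$-linear isomorphism from the residue class field of $P_i$ (identified with $\mathbb{F}_{q^{k_i}}$) onto $C_i$. Let $\mathcal{C}=C(P_1,\ldots,P_s:G:C_1,\ldots,C_s)$ be the associated generalized algebraic-geometric code. If there exists $r\in\mathbb{N}$ such that for all $1\le i\le s$ we have $1<k_i\le r$ and $n_i>\deg(P_i)$, then $\mathcal{C}$ has locality $r$.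
   Context: $F/\mathbb{F}_q$ is an algebraic function field (of one variable) with full constant field $\mathbb{F}_q$; $\mathcal{L}(G)$ is the Riemann-Roch space of the divisor $G$. For a place $P$ of degree $d$ and a function $f$ regular at $P$, $f(P)$ denotes the class of $f$ in the residue class field of $P$, which is isomorphic to $\mathbb{F}_{q^d}$. An $[n,k,d]$ code over $\mathbb{F}_q$ is a linear code of length $n$, dimension $k$ and minimum distance $d$. Generalized AG code: $C(P_1,\ldots,P_s:G:C_1,\ldots,C_s)$ is the image of the map $\alpha:\mathcal{L}(G)\to\mathbb{F}_q^n$, $f\mapsto(\pi_1(f(P_1)),\ldots,\pi_s(f(P_s)))$, where $n=\sum_{i=1}^s n_i$ (the vectors $\pi_i(f(P_i))\in C_i\subset\mathbb{F}_q^{n_i}$ are concatenated). Locality: a linear code $\mathcal{C}\subset\mathbb{F}_q^n$ has locality $r$ (is locally recoverable with locality $r$) if every symbol of a codeword can be recovered from at most $r$ other symbols, i.e. for each $1\le i\le n$ there is a set $N_i\subset\{1,\ldots,n\}\smallsetminus\{i\}$ with $|N_i|\le r$ such that, for all $c\in\mathcal{C}$, $c_i$ is determined by $(c_j)_{j\in N_i}$. (Here $r$ is not required to be minimal.) *)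

theory Defs
  imports "HOL-Algebra.Algebra"
begin

section \<open>Algebraic function fields, places and divisors\<close>

text \<open>Terminology follows Stichtenoth, \<^emph>\<open>Algebraic Function Fields and Codes\<close>, Chapter 1.
  The constant field is a subset \<open>K\<close> of the function field \<open>F\<close>; the last conjunct says that it is the
  full constant field.\<close>

definition function_field :: "('a, 'm) ring_scheme \<Rightarrow> 'a set \<Rightarrow> bool" where
  "function_field F K \<longleftrightarrow>
     field F \<and> subfield K F \<and>
     (\<exists>x \<in> carrier F. ring.transcendental F K x \<and>
        ring.finite_dimension F (generate_field F (insert x K)) (carrier F)) \<and>
     (\<forall>a \<in> carrier F. ring.algebraic F K a \<longrightarrow> a \<in> K)"

definition valuation_ring :: "('a, 'm) ring_scheme \<Rightarrow> 'a set \<Rightarrow> 'a set \<Rightarrow> bool" where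
  "valuation_ring F K V \<longleftrightarrow>
     subring V F \<and> K \<subset> V \<and> V \<subset> carrier F \<and>
     (\<forall>z \<in> carrier F - {\<zero>\<^bsub>F\<^esub>}. z \<in> V \<or> inv\<^bsub>F\<^esub> z \<in> V)"

text \<open>A place is (as a set) the maximal ideal of a valuation ring, which it determines.\<close>

definition places :: "('a, 'm) ring_scheme \<Rightarrow> 'a set \<Rightarrow> 'a set set" where
  "places F K = {P. \<exists>V. valuation_ring F K V \<and> maximalideal P (F\<lparr>carrier := V\<rparr>)}"

definition place_ring :: "('a, 'm) ring_scheme \<Rightarrow> 'a set \<Rightarrow> 'a set \<Rightarrow> ('a, 'm) ring_scheme" where
  "place_ring F K P =
     F\<lparr>carrier := (THE V. valuation_ring F K V \<and> maximalideal P (F\<lparr>carrier := V\<rparr>))\<rparr>"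

text \<open>The normalized discrete valuation of \<open>P\<close>: \<open>z = t\<^sup>n u\<close> with \<open>t\<close> a prime element and \<open>u\<close> a unit of
  the valuation ring. It is meaningful for \<open>z \<noteq> 0\<close> only; the convention \<open>v(0) = \<infinity>\<close> is
  built into the uses below.\<close>

definition place_val :: "('a, 'm) ring_scheme \<Rightarrow> 'a set \<Rightarrow> 'a set \<Rightarrow> 'a \<Rightarrow> int" where
  "place_val F K P z =
     (THE n. \<exists>t u. t \<in> carrier (place_ring F K P) \<and> P = PIdl\<^bsub>place_ring F K P\<^esub> t \<and>
        u \<in> Units (place_ring F K P) \<and> z = t [^]\<^bsub>F\<^esub> n \<otimes>\<^bsub>F\<^esub> u)"

definition residue_field :: "('a, 'm) ring_scheme \<Rightarrow> 'a set \<Rightarrow> 'a set \<Rightarrow> 'a set ring" where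
  "residue_field F K P = place_ring F K P Quot P"

text \<open>The residue class \<open>f(P)\<close>, for \<open>f\<close> regular at \<open>P\<close>.\<close>

definition eval_at :: "('a, 'm) ring_scheme \<Rightarrow> 'a set \<Rightarrow> 'a set \<Rightarrow> 'a \<Rightarrow> 'a set" where
  "eval_at F K P f = P +>\<^bsub>place_ring F K P\<^esub> f"

text \<open>The constant field is embedded into the residue class field by \<open>a \<mapsto> a(P)\<close>.\<close>

definition place_degree :: "('a, 'm) ring_scheme \<Rightarrow> 'a set \<Rightarrow> 'a set \<Rightarrow> nat" where
  "place_degree F K P =
     ring.dim (residue_field F K P) (eval_at F K P ` K) (carrier (residue_field F K P))"

definition supp :: "('a set \<Rightarrow> int) \<Rightarrow> 'a set set" where
  "supp D = {P. D P \<noteq> 0}"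

definition divisors :: "('a, 'm) ring_scheme \<Rightarrow> 'a set \<Rightarrow> ('a set \<Rightarrow> int) set" where
  "divisors F K = {D. finite (supp D) \<and> supp D \<subseteq> places F K}"

definition divisor_degree :: "('a, 'm) ring_scheme \<Rightarrow> 'a set \<Rightarrow> ('a set \<Rightarrow> int) \<Rightarrow> int" where
  "divisor_degree F K D = (\<Sum>P \<in> supp D. D P * int (place_degree F K P))"

definition riemann_roch :: "('a, 'm) ring_scheme \<Rightarrow> 'a set \<Rightarrow> ('a set \<Rightarrow> int) \<Rightarrow> 'a set" where
  "riemann_roch F K D =
     {f \<in> carrier F. f = \<zero>\<^bsub>F\<^esub> \<or> (\<forall>P \<in> places F K. place_val F K P f \<ge> - D P)}"

definition genus :: "('a, 'm) ring_scheme \<Rightarrow> 'a set \<Rightarrow> int" where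
  "genus F K = (GREATEST m. \<exists>D \<in> divisors F K.
     m = divisor_degree F K D - int (ring.dim F K (riemann_roch F K D)) + 1)"


section \<open>Linear codes\<close>

text \<open>Words of length \<open>n\<close> over \<open>K\<close> are lists; positions are numbered from 0.\<close>

definition words :: "'a set \<Rightarrow> nat \<Rightarrow> 'a list set" where
  "words K n = {w. length w = n \<and> set w \<subseteq> K}"

definition linear_code :: "('a, 'm) ring_scheme \<Rightarrow> 'a set \<Rightarrow> nat \<Rightarrow> 'a list set \<Rightarrow> bool" where
  "linear_code F K n C \<longleftrightarrow>
     C \<subseteq> words K n \<and> replicate n \<zero>\<^bsub>F\<^esub> \<in> C \<and>
     (\<forall>c \<in> C. \<forall>c' \<in> C. map2 (\<oplus>\<^bsub>F\<^esub>) c c' \<in> C) \<and>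
     (\<forall>a \<in> K. \<forall>c \<in> C. map ((\<otimes>\<^bsub>F\<^esub>) a) c \<in> C)"

definition lin_comb :: "('a, 'm) ring_scheme \<Rightarrow> nat \<Rightarrow> 'a list list \<Rightarrow> 'a list \<Rightarrow> 'a list" where
  "lin_comb F n bs as =
     map (\<lambda>i. \<Oplus>\<^bsub>F\<^esub>j \<in> {..<length bs}. as ! j \<otimes>\<^bsub>F\<^esub> bs ! j ! i) [0..<n]"

definition code_basis :: "('a, 'm) ring_scheme \<Rightarrow> 'a set \<Rightarrow> nat \<Rightarrow> 'a list list \<Rightarrow> 'a list set \<Rightarrow> bool" where
  "code_basis F K n bs C \<longleftrightarrow>
     set bs \<subseteq> C \<and> bij_betw (lin_comb F n bs) (words K (length bs)) C"

definition hamming_dist :: "'a list \<Rightarrow> 'a list \<Rightarrow> nat" where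
  "hamming_dist c c' = card {i. i < length c \<and> c ! i \<noteq> c' ! i}"

definition min_distance :: "'a list set \<Rightarrow> nat \<Rightarrow> bool" where
  "min_distance C d \<longleftrightarrow>
     (\<exists>c \<in> C. \<exists>c' \<in> C. c \<noteq> c' \<and> hamming_dist c c' = d) \<and>
     (\<forall>c \<in> C. \<forall>c' \<in> C. c \<noteq> c' \<longrightarrow> d \<le> hamming_dist c c')"

text \<open>\<open>C\<close> is an \<open>[n,k,d]\<close> code over \<open>K\<close>.\<close>

definition nkd_code :: "('a, 'm) ring_scheme \<Rightarrow> 'a set \<Rightarrow> nat \<Rightarrow> nat \<Rightarrow> nat \<Rightarrow> 'a list set \<Rightarrow> bool" where
  "nkd_code F K n k d C \<longleftrightarrow>
     linear_code F K n C \<and> (\<exists>bs. length bs = k \<and> code_basis F K n bs C) \<and> min_distance C d"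

text \<open>The number \<open>r\<close> is not required to be minimal.\<close>

definition has_locality :: "nat \<Rightarrow> 'a list set \<Rightarrow> nat \<Rightarrow> bool" where
  "has_locality n C r \<longleftrightarrow>
     (\<forall>i < n. \<exists>N \<subseteq> {..<n} - {i}. card N \<le> r \<and>
        (\<forall>c \<in> C. \<forall>c' \<in> C. (\<forall>j \<in> N. c ! j = c' ! j) \<longrightarrow> c ! i = c' ! i))"


section \<open>Generalized algebraic-geometric codes\<close>

text \<open>\<open>\<pi>\<close> is a \<open>K\<close>-linear isomorphism from the residue class field of \<open>P\<close> onto the code \<open>C\<close>.\<close>

definition residue_iso ::
    "('a, 'm) ring_scheme \<Rightarrow> 'a set \<Rightarrow> 'a set \<Rightarrow> 'a list set \<Rightarrow> ('a set \<Rightarrow> 'a list) \<Rightarrow> bool" where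
  "residue_iso F K P C \<pi> \<longleftrightarrow>
     bij_betw \<pi> (carrier (residue_field F K P)) C \<and>
     (\<forall>x \<in> carrier (residue_field F K P). \<forall>y \<in> carrier (residue_field F K P).
        \<pi> (x \<oplus>\<^bsub>residue_field F K P\<^esub> y) = map2 (\<oplus>\<^bsub>F\<^esub>) (\<pi> x) (\<pi> y)) \<and>
     (\<forall>a \<in> K. \<forall>x \<in> carrier (residue_field F K P).
        \<pi> (eval_at F K P a \<otimes>\<^bsub>residue_field F K P\<^esub> x) = map ((\<otimes>\<^bsub>F\<^esub>) a) (\<pi> x))"

text \<open>The codes \<open>C\<^sub>i\<close> enter only as the ranges of the maps \<open>\<pi>\<^sub>i\<close>.\<close>

definition gag_code ::
    "('a, 'm) ring_scheme \<Rightarrow> 'a set \<Rightarrow> nat \<Rightarrow> (nat \<Rightarrow> 'a set) \<Rightarrow> ('a set \<Rightarrow> int) \<Rightarrow>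
     (nat \<Rightarrow> 'a set \<Rightarrow> 'a list) \<Rightarrow> 'a list set" where
  "gag_code F K s P G \<pi> =
     (\<lambda>f. concat (map (\<lambda>i. \<pi> i (eval_at F K (P i) f)) [1..<Suc s])) ` riemann_roch F K G"

end

theory Submission
  imports Defs
begin

text \<open>The symbols of a codeword at \<open>P\<^sub>i\<close> form a word of \<open>C\<^sub>i\<close>, so they are recovered inside that
  block, from at most \<open>k\<^sub>i \<le> r\<close> other symbols. The point that needs an argument is that \<open>f(P\<^sub>i)\<close> really is a
  residue class: \<open>v\<^bsub>P\<^esub>(f) \<ge> 0\<close> must imply that \<open>f\<close> is regular at \<open>P\<close>, which rests on the valuation ring
  of \<open>P\<close> being discrete. Let \<open>F\<close> be finite over \<open>K(y)\<close> and say \<open>y\<close> is regular at \<open>P\<close> (else take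
  \<open>1/y\<close>). By division with remainder in \<open>K[y]\<close>, every nonzero element of \<open>K(y)\<close> is a power of a fixed \<open>w \<in> P\<close>
  times a unit. Elements whose values are incongruent modulo the value of \<open>w\<close> are linearly
  independent over \<open>K(y)\<close>, so some \<open>N > 0\<close> makes every \<open>z\<^sup>N\<close> a power of \<open>w\<close> times a unit, which
  embeds the value group into the integers.\<close>

section \<open>Powers and units in a field\<close>

context field
begin

lemma inv_nz: "x \<in> carrier R - {\<zero>} \<Longrightarrow> inv x \<in> carrier R - {\<zero>}"
  using field_Units Units_inv_Units by blast

lemma mult_nz: "x \<in> carrier R - {\<zero>} \<Longrightarrow> y \<in> carrier R - {\<zero>} \<Longrightarrow> x \<otimes> y \<in> carrier R - {\<zero>}"
  using integral by auto

lemma inv_cancel: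
  assumes "x \<in> carrier R - {\<zero>}"
  shows "x \<otimes> inv x = \<one>" "inv x \<otimes> x = \<one>" "inv (inv x) = x"
  using assms field_Units Units_r_inv Units_l_inv Units_inv_inv by auto

lemma inv_mult_nz:
  assumes "x \<in> carrier R - {\<zero>}" "y \<in> carrier R - {\<zero>}"
  shows "inv (x \<otimes> y) = inv x \<otimes> inv y"
proof -
  have c: "x \<in> carrier R" "y \<in> carrier R" "inv x \<in> carrier R" "inv y \<in> carrier R"
    using assms inv_nz by blast+
  have "(x \<otimes> y) \<otimes> (inv x \<otimes> inv y) = (x \<otimes> inv x) \<otimes> (y \<otimes> inv y)"
    using c by algebra
  then show ?thesis
    using c inv_cancel(1)[OF assms(1)] inv_cancel(1)[OF assms(2)] comm_inv_char[of "x \<otimes> y" "inv x \<otimes> inv y"]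
    by simp
qed

lemma pow_nz: "x \<in> carrier R - {\<zero>} \<Longrightarrow> x [^] (n::nat) \<in> carrier R - {\<zero>}"
  by (induction n) (auto simp: integral_iff)

text \<open>\<open>R\<close> is only a monoid under multiplication, so the laws for negative
  exponents are taken from the group \<open>units_of R\<close> and carried over by this
  identity.\<close>

lemma int_pow_units_of:
  assumes "x \<in> carrier R - {\<zero>}"
  shows "x [^]\<^bsub>units_of R\<^esub> (k::int) = x [^] k"
proof -
  have *: "x [^]\<^bsub>units_of R\<^esub> n = x [^] n" for n :: nat
    by (simp add: nat_pow_def units_of_mult units_of_one)
  have "inv\<^bsub>units_of R\<^esub> (x [^] nat (-k)) = inv (x [^] nat (-k))"
    using units_of_inv pow_nz[OF assms] field_Units by simp
  then show ?thesis
    unfolding int_pow_def2 * by (simp del: pow_nat)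
qed

text \<open>Subgroups \<open>H\<close> of the unit group serve below as moduli for comparing values;
  their closure laws are needed in the operations of \<open>R\<close> itself.\<close>

lemma subgroup_units_of:
  assumes H: "subgroup H (units_of R)"
  shows "H \<subseteq> carrier R - {\<zero>}"
    and "x \<in> H \<Longrightarrow> y \<in> H \<Longrightarrow> x \<otimes> y \<in> H"
    and "x \<in> H \<Longrightarrow> inv x \<in> H"
    and "x \<in> H \<Longrightarrow> x [^] (n::nat) \<in> H"
proof -
  show sub: "H \<subseteq> carrier R - {\<zero>}"
    using subgroup.subset[OF H] by (simp add: units_of_carrier field_Units)
  show mult: "x \<otimes> y \<in> H" if "x \<in> H" "y \<in> H" for x y
    using subgroup.m_closed[OF H that] by (simp add: units_of_mult)
  show "inv x \<in> H" if "x \<in> H"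
    using subgroup.m_inv_closed[OF H that] units_of_inv[of x] that sub field_Units by (metis subsetD)
  show "x [^] n \<in> H" if "x \<in> H"
    using that mult subgroup.one_closed[OF H] by (induction n) (auto simp: units_of_one)
qed

lemma int_pow_nz:
  assumes "x \<in> carrier R - {\<zero>}"
  shows "x [^] (k::int) \<in> carrier R - {\<zero>}"
  using group.int_pow_closed[OF units_group, of x k] assms
  by (simp add: int_pow_units_of units_of_carrier field_Units)

lemma int_pow_add:
  assumes "x \<in> carrier R - {\<zero>}"
  shows "x [^] (k + l::int) = x [^] k \<otimes> x [^] l"
  using group.int_pow_mult[OF units_group, of x k l] assms
  by (simp add: int_pow_units_of units_of_carrier units_of_mult field_Units)

lemma int_pow_minus:
  assumes "x \<in> carrier R - {\<zero>}"
  shows "x [^] (-k::int) = inv (x [^] k)"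
  using group.int_pow_neg[OF units_group, of x k] int_pow_nz[OF assms] assms
  by (simp add: int_pow_units_of units_of_carrier units_of_inv field_Units)

end


section \<open>Valuation rings\<close>

text \<open>The value of \<open>z\<close> in the ordered group attached to \<open>V\<close> is its class modulo \<open>vunits\<close>.\<close>

locale valued_field = field F for F (structure) +
  fixes V :: "'a set"
  assumes V_subring: "subring V F"
    and V_total: "z \<in> carrier F - {\<zero>} \<Longrightarrow> z \<in> V \<or> inv z \<in> V"
begin

definition vunits :: "'a set" where
  "vunits = {u \<in> V. u \<noteq> \<zero> \<and> inv u \<in> V}"

text \<open>By \<open>maximalideal_eq_vmax\<close> the nonunits are the only candidate for a maximal
  ideal of \<open>V\<close>, so a place can be replaced by this set.\<close>

definition vmax :: "'a set" where
  "vmax = V - vunits"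

lemmas V_carrier = subringE(1)[OF V_subring]
lemmas V_closed = subringE(2-7)[OF V_subring]

lemma vunits_nz: "u \<in> vunits \<Longrightarrow> u \<in> carrier F - {\<zero>}"
  using V_carrier by (auto simp: vunits_def)

lemma vunits_V: "u \<in> vunits \<Longrightarrow> u \<in> V"
  by (simp add: vunits_def)

lemma vunits_one: "\<one> \<in> vunits"
  using V_closed by (simp add: vunits_def)

lemma vunits_inv: "u \<in> vunits \<Longrightarrow> inv u \<in> vunits"
  using inv_nz[OF vunits_nz] inv_cancel(3)[OF vunits_nz] by (simp add: vunits_def)

lemma vunits_mult: "u \<in> vunits \<Longrightarrow> u' \<in> vunits \<Longrightarrow> u \<otimes> u' \<in> vunits"
  using mult_nz[OF vunits_nz vunits_nz, of u u'] inv_mult_nz[OF vunits_nz vunits_nz, of u u'] V_closed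
  by (auto simp: vunits_def)

lemma vmax_V: "p \<in> vmax \<Longrightarrow> p \<in> V"
  by (simp add: vmax_def)

lemma vmax_zero: "\<zero> \<in> vmax"
  using V_closed by (simp add: vmax_def vunits_def)

lemma vmax_iff_inv:
  assumes "z \<in> carrier F - {\<zero>}"
  shows "z \<in> vmax \<longleftrightarrow> inv z \<notin> V"
  using assms V_total[of z] by (auto simp: vmax_def vunits_def)

text \<open>Were the product a unit, \<open>inv p\<close> would be \<open>x\<close> times its
  inverse, hence in \<open>V\<close>, and \<open>p\<close> would be a unit.\<close>

lemma vmax_mult:
  assumes "x \<in> V" "p \<in> vmax"
  shows "x \<otimes> p \<in> vmax"
proof (rule ccontr)
  assume "x \<otimes> p \<notin> vmax"
  have c: "x \<in> carrier F" "p \<in> carrier F"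
    using assms V_carrier vmax_V by auto
  have u: "x \<otimes> p \<in> vunits"
    using \<open>x \<otimes> p \<notin> vmax\<close> V_closed(5) assms vmax_V by (auto simp: vmax_def)
  then have nz: "x \<in> carrier F - {\<zero>}" "p \<in> carrier F - {\<zero>}"
    using vunits_nz[OF u] c by auto
  have "inv p = x \<otimes> inv (x \<otimes> p)"
    using nz inv_nz inv_cancel
    by (simp add: inv_mult_nz m_assoc[symmetric])
  moreover have "x \<otimes> inv (x \<otimes> p) \<in> V"
    using V_closed(5) assms(1) vunits_V[OF vunits_inv[OF u]] by blast
  ultimately show False
    using vmax_iff_inv[OF nz(2)] assms(2) by simp
qed

lemma vmax_mult_right: "p \<in> vmax \<Longrightarrow> x \<in> V \<Longrightarrow> p \<otimes> x \<in> vmax"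
  using vmax_mult m_comm V_carrier vmax_V by (metis subsetD)

lemma vmax_uminus: "p \<in> vmax \<Longrightarrow> \<ominus> p \<in> vmax"
  using vmax_mult[of "\<ominus> \<one>" p] V_closed V_carrier vmax_V[of p] l_minus[of \<one> p] by auto

text \<open>Locality of \<open>V\<close>: if \<open>p\<close> and \<open>q = 1 + p\<close> were both
  nonunits, then \<open>1 = q - p\<close>, and by totality one of \<open>q/p\<close>,
  \<open>p/q\<close> lies in \<open>V\<close>, so 1 would be a \<open>V\<close>-multiple of one of
  the two nonunits.\<close>

lemma one_plus_vmax:
  assumes "p \<in> V" "\<one> \<oplus> p \<in> vmax"
  shows "p \<in> vunits"
proof (rule ccontr)
  assume "p \<notin> vunits"
  then have p: "p \<in> vmax" using assms by (simp add: vmax_def)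
  define q where "q = \<one> \<oplus> p"
  have c: "p \<in> carrier F" "q \<in> carrier F" using assms V_carrier vmax_V q_def by auto
  have q: "q \<in> vmax" using assms q_def by simp
  have sum: "q \<oplus> \<ominus> p = \<one>" using c q_def by algebra
  show False
  proof (cases "p = \<zero>")
    case True
    then show False using q vunits_one by (simp add: q_def vmax_def)
  next
    case False
    then have pn: "p \<in> carrier F - {\<zero>}" using c by simp
    show False
    proof (cases "q = \<zero>")
      case True
      then have "p = \<ominus> \<one>" using c q_def by (metis add.m_comm minus_equality one_closed)
      then have "\<one> \<in> vmax" using vmax_uminus[OF p] by simp
      then show False using vunits_one by (simp add: vmax_def)
    next
      case False
      then have qn: "q \<in> carrier F - {\<zero>}" using c by simp
      have r: "q \<otimes> inv p \<in> carrier F - {\<zero>}" using mult_nz inv_nz pn qn by blast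
      have "inv (q \<otimes> inv p) = p \<otimes> inv q"
        using pn qn inv_nz inv_cancel by (simp add: inv_mult_nz m_comm)
      then consider "q \<otimes> inv p \<in> V" | "p \<otimes> inv q \<in> V" using V_total[OF r] by auto
      then have "\<one> \<in> vmax"
      proof cases
        case 1
        have "q = (q \<otimes> inv p) \<otimes> p" using pn qn inv_nz inv_cancel by (simp add: m_assoc)
        then have "\<one> = (q \<otimes> inv p) \<otimes> p \<oplus> \<ominus> p" using sum by simp
        also have "\<dots> = (q \<otimes> inv p \<oplus> \<ominus> \<one>) \<otimes> p" using r pn by (simp add: l_distr l_minus)
        finally have "\<one> = (q \<otimes> inv p \<oplus> \<ominus> \<one>) \<otimes> p" .
        moreover have "q \<otimes> inv p \<oplus> \<ominus> \<one> \<in> V" by (intro V_closed 1)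
        ultimately show ?thesis using vmax_mult[OF _ p] by metis
      next
        case 2
        have pq: "p \<otimes> inv q \<in> carrier F" using 2 V_carrier by auto
        have "p = (p \<otimes> inv q) \<otimes> q" using pn qn inv_nz inv_cancel by (simp add: m_assoc)
        then have "\<one> = q \<oplus> \<ominus> ((p \<otimes> inv q) \<otimes> q)" using sum by simp
        also have "\<dots> = (\<one> \<oplus> \<ominus> (p \<otimes> inv q)) \<otimes> q" using pq qn by (simp add: l_distr l_minus)
        finally have "\<one> = (\<one> \<oplus> \<ominus> (p \<otimes> inv q)) \<otimes> q" .
        moreover have "\<one> \<oplus> \<ominus> (p \<otimes> inv q) \<in> V" by (intro V_closed 2)
        ultimately show ?thesis using vmax_mult[OF _ q] by metis
      qed
      then show False using vunits_one by (simp add: vmax_def)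
    qed
  qed
qed

lemma one_plus_vmax_vunits: "p \<in> vmax \<Longrightarrow> \<one> \<oplus> p \<in> vunits"
  using one_plus_vmax[of p] V_closed(6)[OF V_closed(2) vmax_V[of p]] unfolding vmax_def by blast

lemma vunits_plus_vmax:
  assumes "u \<in> vunits" "p \<in> vmax"
  shows "u \<oplus> p \<in> vunits"
proof -
  have u: "u \<in> carrier F - {\<zero>}" using vunits_nz assms by blast
  have p: "p \<in> carrier F" using assms V_carrier vmax_V by auto
  have "u \<otimes> (\<one> \<oplus> inv u \<otimes> p) = u \<oplus> p"
    using u p inv_nz[OF u] inv_cancel[OF u] by (simp add: r_distr m_assoc[symmetric])
  moreover have "inv u \<otimes> p \<in> vmax" using assms vunits_V vunits_inv vmax_mult by blast
  ultimately show ?thesis using one_plus_vmax_vunits vunits_mult assms(1) by metis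
qed

text \<open>Adding the nonunit \<open>\<ominus> q\<close> to a unit \<open>p \<oplus> q\<close>
  would leave a unit, namely \<open>p\<close>.\<close>

lemma vmax_add:
  assumes "p \<in> vmax" "q \<in> vmax"
  shows "p \<oplus> q \<in> vmax"
proof (rule ccontr)
  assume "p \<oplus> q \<notin> vmax"
  then have "p \<oplus> q \<in> vunits" using V_closed(6)[OF assms[THEN vmax_V]] by (simp add: vmax_def)
  then have "(p \<oplus> q) \<oplus> \<ominus> q \<in> vunits" using vunits_plus_vmax vmax_uminus[OF assms(2)] by blast
  moreover have "(p \<oplus> q) \<oplus> \<ominus> q = p"
    using assms V_carrier vmax_V by (metis a_assoc a_inv_closed r_neg r_zero subset_iff)
  ultimately show False using assms(1) by (simp add: vmax_def)
qed

lemma vmax_pow: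
  assumes "p \<in> vmax" "0 < n"
  shows "p [^] (n::nat) \<in> vmax"
proof -
  have p: "p \<in> carrier F" using assms(1) V_carrier vmax_V[of p] by auto
  have "p [^] Suc m \<in> vmax" for m
  proof (induction m)
    case 0
    show ?case using p assms(1) by simp
  next
    case (Suc m)
    then show ?case using vmax_mult[OF vmax_V assms(1)] nat_pow_Suc by metis
  qed
  then show ?thesis using assms(2) gr0_implies_Suc by blast
qed

text \<open>Strict triangle inequality: if \<open>a\<close> and \<open>b\<close> have different
  values, factoring out the summand of smaller value leaves 1 plus an element of
  \<open>vmax\<close>, a unit.\<close>

lemma sum_dominated:
  assumes a: "a \<in> carrier F - {\<zero>}" and b: "b \<in> carrier F - {\<zero>}" and "a \<otimes> inv b \<notin> vunits"
  obtains u where "u \<in> vunits" "a \<oplus> b = u \<otimes> a" | u where "u \<in> vunits" "a \<oplus> b = u \<otimes> b"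
proof -
  have r: "a \<otimes> inv b \<in> carrier F - {\<zero>}" using mult_nz inv_nz a b by blast
  show thesis
  proof (cases "a \<otimes> inv b \<in> V")
    case True
    then have "\<one> \<oplus> a \<otimes> inv b \<in> vunits" using one_plus_vmax_vunits assms(3) by (simp add: vmax_def)
    moreover have "a \<oplus> b = (\<one> \<oplus> a \<otimes> inv b) \<otimes> b"
      using a b inv_nz[OF b] inv_cancel[OF b] by (simp add: l_distr m_assoc add.m_comm)
    ultimately show thesis using that(2) by blast
  next
    case False
    have eq: "inv (a \<otimes> inv b) = b \<otimes> inv a"
      using a b inv_nz inv_cancel by (simp add: inv_mult_nz m_comm)
    have "b \<otimes> inv a \<in> vmax"
      using False vmax_iff_inv[OF inv_nz[OF r]] inv_cancel(3)[OF r] eq by simp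
    then have "\<one> \<oplus> b \<otimes> inv a \<in> vunits" using one_plus_vmax_vunits by blast
    moreover have "a \<oplus> b = (\<one> \<oplus> b \<otimes> inv a) \<otimes> a"
      using a b inv_nz[OF a] inv_cancel[OF a] by (simp add: l_distr m_assoc)
    ultimately show thesis using that(1) by blast
  qed
qed

end


section \<open>A finite extension has a value group of bounded exponent\<close>

context valued_field
begin

lemma div_mult_div:
  assumes "x \<in> carrier F - {\<zero>}" "y \<in> carrier F - {\<zero>}" "z \<in> carrier F - {\<zero>}"
  shows "(x \<otimes> inv y) \<otimes> (y \<otimes> inv z) = x \<otimes> inv z"
proof -
  have c: "x \<in> carrier F" "y \<in> carrier F" "inv y \<in> carrier F" "inv z \<in> carrier F"
    using assms inv_nz by blast+
  then have "(x \<otimes> inv y) \<otimes> (y \<otimes> inv z) = (inv y \<otimes> y) \<otimes> (x \<otimes> inv z)"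
    by algebra
  then show ?thesis using c inv_cancel(2)[OF assms(2)] by simp
qed

lemma inv_div:
  assumes "x \<in> carrier F - {\<zero>}" "y \<in> carrier F - {\<zero>}"
  shows "inv (x \<otimes> inv y) = y \<otimes> inv x"
  using inv_mult_nz[OF assms(1) inv_nz[OF assms(2)]] inv_cancel(3)[OF assms(2)]
    m_comm[of "inv x" y] inv_nz[OF assms(1)] assms(2) by simp

lemma mult_div:
  assumes "x \<in> carrier F" "y \<in> carrier F - {\<zero>}"
  shows "(x \<otimes> y) \<otimes> inv y = x"
  using assms inv_nz[OF assms(2)] inv_cancel(1)[OF assms(2)] by (simp add: m_assoc)

text \<open>Modulo \<open>H\<close> the values of \<open>L\<close> vanish. In
  \<open>z = k u + v\<close> with both terms nonzero, \<open>v\<close> is congruent to some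
  \<open>w\<close> of the tail by induction; as \<open>u\<close> and \<open>w\<close> are
  incongruent, \<open>k u\<close> and \<open>v\<close> differ in value, and the sum inherits the
  class of \<open>u\<close> or of \<open>w\<close>.\<close>

lemma Span_congruent:
  assumes L: "subfield L F" and H: "subgroup H (units_of F)"
    and "vunits \<subseteq> H" "L - {\<zero>} \<subseteq> H"
  shows "set Us \<subseteq> carrier F - {\<zero>} \<Longrightarrow> sorted_wrt (\<lambda>a b. a \<otimes> inv b \<notin> H) Us \<Longrightarrow>
    z \<in> Span L Us \<Longrightarrow> z \<noteq> \<zero> \<Longrightarrow> \<exists>u \<in> set Us. z \<otimes> inv u \<in> H"
proof (induction Us arbitrary: z)
  case Nil
  then show ?case by simp
next
  case (Cons u Us)
  note H_mult = subgroup_units_of(2)[OF H] and H_inv = subgroup_units_of(3)[OF H]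
  have u: "u \<in> carrier F - {\<zero>}" using Cons.prems(1) by simp
  obtain k v where k: "k \<in> L" and v: "v \<in> Span L Us" and z: "z = k \<otimes> u \<oplus> v"
    using Cons.prems(3) by (auto simp: line_extension_mem_iff)
  have Lc: "L \<subseteq> carrier F" using subfieldE(3)[OF L] .
  have kc: "k \<in> carrier F" using k Lc by blast
  have "set Us \<subseteq> carrier F" using Cons.prems(1) by auto
  then have vc: "v \<in> carrier F" using Span_in_carrier[OF Lc] v by blast
  show ?case
  proof (cases "v = \<zero>")
    case True
    then have zk: "z = k \<otimes> u" using z kc u by simp
    then have "k \<noteq> \<zero>" using Cons.prems(4) u by auto
    then have "z \<otimes> inv u \<in> H" using zk mult_div[OF kc u] k assms(4) by auto
    then show ?thesis by simp
  next
    case False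
    then have vn: "v \<in> carrier F - {\<zero>}" using vc by simp
    obtain w where w: "w \<in> set Us" "v \<otimes> inv w \<in> H"
      using Cons.IH[OF _ _ v False] Cons.prems(1,2) by auto
    have wn: "w \<in> carrier F - {\<zero>}" using w Cons.prems(1) by auto
    have uw: "u \<otimes> inv w \<notin> H" using Cons.prems(2) w(1) by simp
    show ?thesis
    proof (cases "k = \<zero>")
      case True
      then show ?thesis using z u vc w by auto
    next
      case False
      then have kn: "k \<in> carrier F - {\<zero>}" and kH: "k \<in> H" using kc k assms(4) by auto
      define a where "a = k \<otimes> u"
      have a: "a \<in> carrier F - {\<zero>}" using mult_nz[OF kn u] a_def by simp
      have au: "a \<otimes> inv u = k" using mult_div[OF kc u] a_def by simp
      \<comment> \<open>A unit quotient would put \<open>u\<close>, \<open>a\<close>,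
        \<open>v\<close> and \<open>w\<close> into one class modulo \<open>H\<close>, since
        \<open>a/u = k\<close> and \<open>v/w\<close> lie in \<open>H\<close>.\<close>
      have "a \<otimes> inv v \<notin> vunits"
      proof
        assume "a \<otimes> inv v \<in> vunits"
        then have "(a \<otimes> inv v) \<otimes> (v \<otimes> inv w) \<in> H" using H_mult w(2) assms(3) by blast
        then have "a \<otimes> inv w \<in> H" using div_mult_div[OF a vn wn] by simp
        moreover have "u \<otimes> inv a \<in> H" using H_inv[OF kH] au inv_div[OF a u] by simp
        ultimately have "(u \<otimes> inv a) \<otimes> (a \<otimes> inv w) \<in> H" using H_mult by blast
        then show False using div_mult_div[OF u a wn] uw by simp
      qed
      from sum_dominated[OF a vn this] show ?thesis
      proof cases
        case (1 e)
        have "e \<in> carrier F" using vunits_nz[OF 1(1)] by simp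
        then have "z \<otimes> inv u = e \<otimes> k"
          using 1(2) au a inv_nz[OF u] z a_def[symmetric] by (simp add: m_assoc)
        then have "z \<otimes> inv u \<in> H" using H_mult 1(1) kH assms(3) by auto
        then show ?thesis by simp
      next
        case (2 e)
        have "e \<in> carrier F" using vunits_nz[OF 2(1)] by simp
        then have "z \<otimes> inv w = e \<otimes> (v \<otimes> inv w)"
          using 2(2) vc inv_nz[OF wn] z a_def[symmetric] by (simp add: m_assoc)
        then have "z \<otimes> inv w \<in> H" using H_mult 2(1) w(2) assms(3) by auto
        then show ?thesis using w(1) by auto
      qed
    qed
  qed
qed

text \<open>An element in the span of the later ones would be congruent to one of them modulo
  \<open>H\<close>.\<close>

lemma independent_if_incongruent:
  assumes L: "subfield L F" and H: "subgroup H (units_of F)"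
    and "vunits \<subseteq> H" "L - {\<zero>} \<subseteq> H"
  shows "set Us \<subseteq> carrier F - {\<zero>} \<Longrightarrow> sorted_wrt (\<lambda>a b. a \<otimes> inv b \<notin> H) Us \<Longrightarrow> independent L Us"
proof (induction Us)
  case (Cons u Us)
  have "u \<notin> Span L Us"
    using Span_congruent[OF assms, of Us u] Cons.prems by auto
  then show ?case using Cons by (auto intro: li_Cons)
qed simp

text \<open>The \<open>d + 1\<close> powers \<open>z^0, ..., z^d\<close> would be independent in
  dimension \<open>d\<close> if they were pairwise incongruent modulo \<open>H\<close>; the quotient
  of two congruent ones is the power sought.\<close>

lemma bounded_power_in_subgroup:
  assumes L: "subfield L F" and H: "subgroup H (units_of F)"
    and "vunits \<subseteq> H" "L - {\<zero>} \<subseteq> H"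
    and "dimension d L (carrier F)" and z: "z \<in> carrier F - {\<zero>}"
  shows "\<exists>m \<in> {1..d}. z [^] (m::nat) \<in> H"
proof (rule ccontr)
  assume neg: "\<not> ?thesis"
  note H_inv = subgroup_units_of(3)[OF H]
  define Us where "Us = map (\<lambda>i. z [^] i) [0..<Suc d]"
  have "z [^] i \<otimes> inv (z [^] j) \<notin> H" if "i < j" "j \<le> d" for i j :: nat
  proof
    assume "z [^] i \<otimes> inv (z [^] j) \<in> H"
    then have "z [^] j \<otimes> inv (z [^] i) \<in> H"
      using H_inv inv_div[OF pow_nz[OF z] pow_nz[OF z]] by metis
    moreover have "z [^] j = z [^] (j - i) \<otimes> z [^] i"
      using that z by (simp add: nat_pow_mult)
    ultimately have "z [^] (j - i) \<in> H"
      using mult_div[OF _ pow_nz[OF z]] pow_nz[OF z] by (metis DiffD1)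
    moreover have "j - i \<in> {1..d}" using that by auto
    ultimately show False using neg by blast
  qed
  then have "sorted_wrt (\<lambda>a b. a \<otimes> inv b \<notin> H) Us"
    by (auto simp: Us_def sorted_wrt_iff_nth_less simp del: upt_Suc)
  moreover have "set Us \<subseteq> carrier F - {\<zero>}" using pow_nz[OF z] by (auto simp: Us_def)
  ultimately have "independent L Us" using independent_if_incongruent[OF assms(1-4)] by blast
  moreover have "set Us \<subseteq> carrier F" using \<open>set Us \<subseteq> carrier F - {\<zero>}\<close> by blast
  ultimately have "length Us \<le> d" using independent_length_le_dimension[OF L assms(5)] by blast
  then show False by (simp add: Us_def)
qed

text \<open>The exponent \<open>m\<close> depends on \<open>z\<close> but is at most
  \<open>d\<close>, so \<open>fact d\<close> is a multiple of it for every \<open>z\<close>.\<close>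

lemma common_power_in_subgroup:
  assumes L: "subfield L F" and H: "subgroup H (units_of F)"
    and "vunits \<subseteq> H" "L - {\<zero>} \<subseteq> H"
    and "finite_dimension L (carrier F)"
  obtains N :: nat where "N > 0" "\<And>z. z \<in> carrier F - {\<zero>} \<Longrightarrow> z [^] N \<in> H"
proof -
  obtain d where d: "dimension d L (carrier F)" using assms(5) by auto
  note H_pow = subgroup_units_of(4)[OF H]
  have "z [^] (fact d :: nat) \<in> H" if z: "z \<in> carrier F - {\<zero>}" for z
  proof -
    obtain m where m: "m \<in> {1..d}" "z [^] m \<in> H"
      using bounded_power_in_subgroup[OF assms(1-4) d z] by blast
    then have "m dvd fact d" by (simp add: dvd_fact)
    then obtain c where "fact d = m * c" by blast
    then have "z [^] (fact d :: nat) = (z [^] m) [^] c" using z by (simp add: nat_pow_pow)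
    then show ?thesis using H_pow m(2) by metis
  qed
  then show thesis using that fact_gt_zero by blast
qed

section \<open>Integer exponents of a nonunit, and a uniformizer from a bounded exponent\<close>

lemma int_pow_vmax:
  assumes "w \<in> vmax" "0 < (k::int)"
  shows "w [^] k \<in> vmax"
  using vmax_pow[OF assms(1), of "nat k"] assms(2) int_pow_int[of F w "nat k"] by simp

lemma vmax_mult_vunits_notin:
  assumes "p \<in> vmax" "u \<in> V"
  shows "p \<otimes> u \<notin> vunits"
  using vmax_mult_right[OF assms] by (simp add: vmax_def)

text \<open>If \<open>k < l\<close>, cancelling \<open>w^k\<close> exhibits the unit
  \<open>u\<close> as \<open>w^(l-k) u'\<close>, which lies in \<open>vmax\<close>; the case
  \<open>l < k\<close> is symmetric.\<close>

lemma int_pow_unit_unique: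
  assumes w: "w \<in> vmax" "w \<noteq> \<zero>" and u: "u \<in> vunits" "u' \<in> vunits"
    and eq: "w [^] (k::int) \<otimes> u = w [^] (l::int) \<otimes> u'"
  shows "k = l"
proof -
  have wn: "w \<in> carrier F - {\<zero>}" using w V_carrier vmax_V by auto
  have *: "\<not> k < l" if u: "u \<in> vunits" "u' \<in> vunits" and eq: "w [^] (k::int) \<otimes> u = w [^] (l::int) \<otimes> u'"
    for k l u u'
  proof
    assume "k < l"
    have c: "w [^] k \<in> carrier F" "w [^] (l - k) \<in> carrier F" "u \<in> carrier F" "u' \<in> carrier F"
      using int_pow_nz[OF wn] u vunits_nz by blast+
    have "w [^] l = w [^] k \<otimes> w [^] (l - k)" using int_pow_add[OF wn, of k "l - k"] by simp
    then have "w [^] k \<otimes> u = w [^] k \<otimes> (w [^] (l - k) \<otimes> u')" using eq c by (simp add: m_assoc)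
    then have "u = w [^] (l - k) \<otimes> u'"
      using m_lcancel[of "w [^] k"] int_pow_nz[OF wn, of k] c by auto
    then show False
      using vmax_mult_vunits_notin[OF int_pow_vmax[OF w(1), of "l - k"] vunits_V[OF u(2)]] u(1) \<open>k < l\<close> by auto
  qed
  then show ?thesis using *[OF u eq] *[OF u(2,1) eq[symmetric]] by simp
qed

text \<open>The exponent \<open>v(z)\<close> of \<open>w\<close> in \<open>z\<^sup>N\<close> embeds the value group into the integers, and any \<open>t\<close> of
  least positive \<open>v(t)\<close> is a uniformizer.\<close>

lemma ex_uniformizer:
  assumes w: "w \<in> vmax" "w \<noteq> \<zero>" and "N > (0::nat)"
    and rep: "\<And>z. z \<in> carrier F - {\<zero>} \<Longrightarrow> \<exists>k::int. \<exists>u \<in> vunits. z [^] N = w [^] k \<otimes> u"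
  obtains t where "t \<in> vmax" "t \<noteq> \<zero>"
    "\<And>z. z \<in> carrier F - {\<zero>} \<Longrightarrow> \<exists>n::int. \<exists>u \<in> vunits. z = t [^] n \<otimes> u"
proof -
  have wn: "w \<in> carrier F - {\<zero>}" using w V_carrier vmax_V by auto
  \<comment> \<open>The exponents are chosen, but \<open>v_eq\<close> shows that the choice is
    forced on nonzero elements; this is why \<open>v\<close> is additive.\<close>
  obtain v :: "'a \<Rightarrow> int" where v: "\<And>z. z \<in> carrier F - {\<zero>} \<Longrightarrow> \<exists>u \<in> vunits. z [^] N = w [^] v z \<otimes> u"
    using rep by metis
  have v_eq: "v z = k" if "z \<in> carrier F - {\<zero>}" "u \<in> vunits" "z [^] N = w [^] k \<otimes> u" for z k u
    using v[OF that(1)] int_pow_unit_unique[OF w] that by metis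
  have v_mult: "v (x \<otimes> y) = v x + v y" if x: "x \<in> carrier F - {\<zero>}" and y: "y \<in> carrier F - {\<zero>}" for x y
  proof -
    obtain a b where a: "a \<in> vunits" "x [^] N = w [^] v x \<otimes> a" and b: "b \<in> vunits" "y [^] N = w [^] v y \<otimes> b"
      using v x y by meson
    have c: "w [^] v x \<in> carrier F" "w [^] v y \<in> carrier F" "a \<in> carrier F" "b \<in> carrier F"
      using int_pow_nz[OF wn] a b vunits_nz by blast+
    have "(x \<otimes> y) [^] N = (w [^] v x \<otimes> a) \<otimes> (w [^] v y \<otimes> b)"
      using x y a b by (simp add: nat_pow_distrib)
    also have "\<dots> = (w [^] v x \<otimes> w [^] v y) \<otimes> (a \<otimes> b)" using c by algebra
    finally have "(x \<otimes> y) [^] N = w [^] (v x + v y) \<otimes> (a \<otimes> b)" using int_pow_add[OF wn] by simp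
    then show ?thesis using v_eq[OF mult_nz[OF x y]] vunits_mult[OF a(1) b(1)] by blast
  qed
  have v_unit: "v z = 0" if z: "z \<in> vunits" for z
  proof (rule v_eq[OF vunits_nz[OF z]])
    show "z [^] N \<in> vunits"
      using vunits_one vunits_mult z by (induction N) auto
    then show "z [^] N = w [^] (0::int) \<otimes> z [^] N" using vunits_nz[of "z [^] N"] by simp
  qed
  \<comment> \<open>If \<open>v z\<close> were at most 0, \<open>w^(-v z)\<close> would lie in
    \<open>V\<close> and its product with \<open>z^N\<close>, an element of \<open>vmax\<close>,
    would be the unit \<open>u\<close>.\<close>
  have v_pos: "v z > 0" if z: "z \<in> vmax" "z \<noteq> \<zero>" for z
  proof (rule ccontr)
    assume neg: "\<not> v z > 0"
    have zn: "z \<in> carrier F - {\<zero>}" using z V_carrier vmax_V by auto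
    obtain u where u: "u \<in> vunits" "z [^] N = w [^] v z \<otimes> u" using v[OF zn] by blast
    have c: "w [^] (- v z) \<in> carrier F" "w [^] v z \<in> carrier F" "u \<in> carrier F"
      using int_pow_nz[OF wn] u vunits_nz by blast+
    have "w [^] (- v z) \<in> V"
      using int_pow_vmax[OF w(1), of "- v z"] neg V_closed(2) vmax_V by (cases "v z = 0") auto
    then have "w [^] (- v z) \<otimes> z [^] N \<in> vmax" using vmax_mult vmax_pow[OF z(1) \<open>N > 0\<close>] by blast
    moreover have "w [^] (- v z) \<otimes> z [^] N = (w [^] (- v z) \<otimes> w [^] v z) \<otimes> u"
      using u(2) c by (simp add: m_assoc)
    moreover have "w [^] (- v z) \<otimes> w [^] v z = \<one>"
      using int_pow_add[OF wn, of "- v z" "v z"] by simp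
    ultimately show False using u(1) c by (simp add: vmax_def)
  qed
  have "\<exists>t. t \<in> vmax \<and> t \<noteq> \<zero>" using w by blast
  \<comment> \<open>Minimising \<open>nat (v t)\<close> is minimising \<open>v t\<close>, because
    \<open>v\<close> is positive on the nonzero elements of \<open>vmax\<close>.\<close>
  from ex_has_least_nat[of "\<lambda>t. t \<in> vmax \<and> t \<noteq> \<zero>" _ "\<lambda>t. nat (v t)"] this obtain t
    where t: "t \<in> vmax" "t \<noteq> \<zero>" and least: "\<And>z. z \<in> vmax \<Longrightarrow> z \<noteq> \<zero> \<Longrightarrow> nat (v t) \<le> nat (v z)"
    by blast
  have tn: "t \<in> carrier F - {\<zero>}" using t V_carrier vmax_V by auto
  have t1: "t [^] (1::int) = t" using int_pow_int[of F t 1] tn by simp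
  \<comment> \<open>Induction on the value: dividing a nonunit \<open>z\<close> by \<open>t\<close>
    lowers the value by \<open>v t > 0\<close>, and minimality of \<open>v t\<close> keeps
    \<open>z/t\<close> in \<open>V\<close>.\<close>
  have pos: "\<exists>n::int. \<exists>u \<in> vunits. z = t [^] n \<otimes> u" if "z \<in> V" "z \<noteq> \<zero>" for z
    using that
  proof (induction "nat (v z)" arbitrary: z rule: less_induct)
    case less
    have zn: "z \<in> carrier F - {\<zero>}" using less.prems V_carrier by auto
    show ?case
    proof (cases "z \<in> vunits")
      case True
      then have "z = t [^] (0::int) \<otimes> z" using zn by simp
      then show ?thesis using True by blast
    next
      case False
      then have zm: "z \<in> vmax" using less.prems by (simp add: vmax_def)
      define y where "y = z \<otimes> inv t"
      have yn: "y \<in> carrier F - {\<zero>}" using mult_nz[OF zn inv_nz[OF tn]] y_def by simp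
      have zy: "z = y \<otimes> t"
        using zn tn inv_nz[OF tn] inv_cancel(2)[OF tn] by (simp add: y_def m_assoc)
      have vz: "v z = v y + v t" using v_mult[OF yn tn] zy by simp
      have vt: "0 < v t" "v t \<le> v z" using v_pos[OF t] least[OF zm less.prems(2)] v_pos[OF zm less.prems(2)] by auto
      have "y \<in> V"
      proof (rule ccontr)
        assume "y \<notin> V"
        then have "inv y \<in> vmax" using vmax_iff_inv[OF inv_nz[OF yn]] inv_cancel(3)[OF yn] by simp
        then have "0 < v (inv y)" using v_pos inv_nz[OF yn] by blast
        moreover have "v (inv y) + v y = 0"
          using v_mult[OF inv_nz[OF yn] yn] inv_cancel(2)[OF yn] v_unit[OF vunits_one] by simp
        ultimately show False using vz vt by simp
      qed
      then obtain n :: int and u where u: "u \<in> vunits" "y = t [^] n \<otimes> u"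
        using less.hyps[of y] vz vt yn by auto
      have c: "t [^] n \<in> carrier F" "u \<in> carrier F" "t \<in> carrier F"
        using int_pow_nz[OF tn] u vunits_nz tn by blast+
      have "z = (t [^] n \<otimes> t) \<otimes> u" using zy u(2) c by (simp add: m_ac)
      then have "z = t [^] (n + 1) \<otimes> u" using int_pow_add[OF tn, of n 1] t1 by simp
      then show ?thesis using u(1) by blast
    qed
  qed
  have "\<exists>n::int. \<exists>u \<in> vunits. z = t [^] n \<otimes> u" if z: "z \<in> carrier F - {\<zero>}" for z
  proof (cases "z \<in> V")
    case True
    then show ?thesis using pos z by blast
  next
    case False
    then have "inv z \<in> V" "inv z \<noteq> \<zero>" using V_total[OF z] inv_nz[OF z] by auto
    then obtain n :: int and u where u: "u \<in> vunits" "inv z = t [^] n \<otimes> u" using pos by blast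
    have "z = inv (t [^] n) \<otimes> inv u"
      using inv_cancel(3)[OF z] u inv_mult_nz[OF int_pow_nz[OF tn] vunits_nz[OF u(1)]] by metis
    then have "z = t [^] (-n) \<otimes> inv u" using int_pow_minus[OF tn] by simp
    then show ?thesis using vunits_inv[OF u(1)] by blast
  qed
  then show thesis using that t by blast
qed

end


section \<open>Valuation rings of a function field are discrete\<close>

text \<open>Fractions over \<open>A\<close> are stable under every generating operation. The
  generators are only asked to be fractions, which later admits \<open>y = 1/x\<close> over
  \<open>A = K[x]\<close>.\<close>

lemma (in field) generate_field_fraction:
  assumes A: "subring A R"
    and H: "\<And>h. h \<in> H \<Longrightarrow> \<exists>a \<in> A. \<exists>b \<in> A - {\<zero>}. h = a \<otimes> inv b"
    and "x \<in> generate_field R H"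
  shows "\<exists>a \<in> A. \<exists>b \<in> A - {\<zero>}. x = a \<otimes> inv b"
  using assms(3)
proof (induction rule: generate_field.induct)
  note Ac = subringE(1)[OF A] and A_closed = subringE(2-7)[OF A]
  have nz: "b \<in> carrier R - {\<zero>}" if "b \<in> A - {\<zero>}" for b using that Ac by blast
  {
    case one
    show ?case using A_closed(2) inv_one by (intro bexI[of _ \<one>]) auto
  next
    case (incl h)
    then show ?case using H by blast
  next
    case (a_inv h)
    then obtain a b where ab: "a \<in> A" "b \<in> A - {\<zero>}" "h = a \<otimes> inv b" by blast
    then have "\<ominus> h = (\<ominus> a) \<otimes> inv b" using Ac inv_nz[OF nz[OF ab(2)]] by (auto simp: l_minus)
    then show ?case using ab(2) A_closed(4)[OF ab(1)] by blast
  next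
    case (m_inv h)
    then obtain a b where ab: "a \<in> A" "b \<in> A - {\<zero>}" "h = a \<otimes> inv b" by blast
    have a: "a \<in> A - {\<zero>}" using ab m_inv(2) inv_nz[OF nz[OF ab(2)]] by auto
    have "inv h = b \<otimes> inv a"
      using ab(3) inv_mult_nz[OF nz[OF a] inv_nz[OF nz[OF ab(2)]]] inv_cancel(3)[OF nz[OF ab(2)]]
        inv_nz[OF nz[OF a]] nz[OF ab(2)] by (simp add: m_comm)
    then show ?case using a ab(2) by blast
  next
    case (eng_add h h')
    then obtain a b a' b' where ab: "a \<in> A" "b \<in> A - {\<zero>}" "h = a \<otimes> inv b"
      and ab': "a' \<in> A" "b' \<in> A - {\<zero>}" "h' = a' \<otimes> inv b'" by blast
    note n = nz[OF ab(2)] nz[OF ab'(2)]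
    have c: "a \<in> carrier R" "a' \<in> carrier R" "b \<in> carrier R" "b' \<in> carrier R" "inv b \<in> carrier R" "inv b' \<in> carrier R"
      using ab ab' Ac inv_nz n by blast+
    have "(a \<otimes> b' \<oplus> a' \<otimes> b) \<otimes> (inv b \<otimes> inv b')
        = (a \<otimes> inv b) \<otimes> (b' \<otimes> inv b') \<oplus> (a' \<otimes> inv b') \<otimes> (b \<otimes> inv b)"
      using c by algebra
    then have "h \<oplus> h' = (a \<otimes> b' \<oplus> a' \<otimes> b) \<otimes> inv (b \<otimes> b')"
      using c inv_cancel(1)[OF n(1)] inv_cancel(1)[OF n(2)] inv_mult_nz[OF n] ab(3) ab'(3) by simp
    moreover have "a \<otimes> b' \<oplus> a' \<otimes> b \<in> A" "b \<otimes> b' \<in> A - {\<zero>}"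
      using ab ab' A_closed(5,6) mult_nz[OF n] by auto
    ultimately show ?case by blast
  next
    case (eng_mult h h')
    then obtain a b a' b' where ab: "a \<in> A" "b \<in> A - {\<zero>}" "h = a \<otimes> inv b"
      and ab': "a' \<in> A" "b' \<in> A - {\<zero>}" "h' = a' \<otimes> inv b'" by blast
    note n = nz[OF ab(2)] nz[OF ab'(2)]
    have c: "a \<in> carrier R" "a' \<in> carrier R" "inv b \<in> carrier R" "inv b' \<in> carrier R"
      using ab ab' Ac inv_nz n by blast+
    have "h \<otimes> h' = (a \<otimes> a') \<otimes> inv (b \<otimes> b')"
      unfolding ab(3) ab'(3) inv_mult_nz[OF n] using c by algebra
    moreover have "a \<otimes> a' \<in> A" "b \<otimes> b' \<in> A - {\<zero>}"
      using ab ab' A_closed(5) mult_nz[OF n] by auto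
    ultimately show ?case by blast
  }
qed

context valued_field
begin

section \<open>Values of the elements of K[y] and K(y)\<close>

lemma subfield_vunits:
  assumes "subfield K F" "K \<subseteq> V" "c \<in> K" "c \<noteq> \<zero>"
  shows "c \<in> vunits"
  using subfield_m_inv(1)[OF assms(1), of c] assms by (auto simp: vunits_def)

text \<open>\<open>w\<close> generates the intersection of the maximal ideal with \<open>K[y]\<close>; it is \<open>0\<close> when this intersection is.\<close>

lemma eval_eq_power_unit:
  assumes K: "subfield K F" "K \<subseteq> V" and y: "y \<in> V"
  shows "\<exists>w \<in> vmax. \<forall>p \<in> carrier (K[X]). eval p y \<noteq> \<zero> \<longrightarrow>
    (\<exists>k::nat. \<exists>u \<in> vunits. eval p y = w [^] k \<otimes> u)"
proof -
  have yc: "y \<in> carrier F" using y V_carrier by blast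
  have Kr: "subring K F" using subfieldE(1)[OF K(1)] .
  interpret E: ring_hom_ring "K[X]" F "\<lambda>p. eval p y" using eval_ring_hom[OF Kr yc] .
  have eval_V: "eval p y \<in> V" if "p \<in> carrier (K[X])" for p
    using simple_extension_subring_incl[OF V_subring K(2) y]
      simple_extension_as_eval_img[OF subfieldE(3)[OF K(1)] yc] that by auto
  define S where "S = {b \<in> carrier (K[X]). b \<noteq> [] \<and> eval b y \<in> vmax}"
  show ?thesis
  proof (cases "S = {}")
    case True
    \<comment> \<open>With \<open>S\<close> empty all nonzero values are units, so
      \<open>w = 0\<close> with exponent 0 serves, as \<open>0^0 = 1\<close>.\<close>
    have "eval p y = \<zero> [^] (0::nat) \<otimes> eval p y \<and> eval p y \<in> vunits"
      if p: "p \<in> carrier (K[X])" "eval p y \<noteq> \<zero>" for p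
    proof -
      have "p \<noteq> []" using p(2) by auto
      then have "eval p y \<in> vunits" using True p(1) eval_V[OF p(1)] by (auto simp: S_def vmax_def)
      then show ?thesis using p(1) by simp
    qed
    then show ?thesis using vmax_zero by blast
  next
    case False
    then obtain b where b: "b \<in> S" and least: "\<And>c. c \<in> S \<Longrightarrow> length b \<le> length c"
      using ex_has_least_nat[of "\<lambda>b. b \<in> S" _ length] by blast
    have bc: "b \<in> carrier (K[X])" "b \<noteq> []" "eval b y \<in> vmax" using b by (auto simp: S_def)
    have bp: "polynomial K b" using bc(1) univ_poly_carrier by blast
    \<comment> \<open>A constant \<open>b\<close> would be a unit of \<open>V\<close>. Positive
      degree makes the quotient shorter in the induction below.\<close>
    have deg_b: "degree b > 0"
    proof (rule ccontr)
      assume "\<not> degree b > 0"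
      then obtain c where c: "b = [c]" using bc(2) by (cases b) auto
      then have "c \<in> K" "c \<noteq> \<zero>" using bp by (auto simp: polynomial_def)
      then have "c \<in> vunits" using subfield_vunits[OF K] by blast
      moreover have "eval b y = c" using c \<open>c \<in> vunits\<close> vunits_nz yc by simp
      ultimately show False using bc(3) by (simp add: vmax_def)
    qed
    have "\<exists>k::nat. \<exists>u \<in> vunits. eval p y = eval b y [^] k \<otimes> u"
      if "p \<in> carrier (K[X])" "eval p y \<noteq> \<zero>" for p
      using that
    proof (induction "length p" arbitrary: p rule: less_induct)
      case less
      \<comment> \<open>A nonzero remainder is shorter than \<open>b\<close>, so its value is a unit
        and so is that of \<open>p\<close> (exponent 0). If the remainder vanishes, one factor
        \<open>eval b y\<close> splits off and the induction continues with
        \<open>q\<close>.\<close>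
      obtain q r where q: "q \<in> carrier (K[X])" and r: "r \<in> carrier (K[X])"
        and p: "p = (b \<otimes>\<^bsub>K[X]\<^esub> q) \<oplus>\<^bsub>K[X]\<^esub> r" and deg: "r = [] \<or> degree r < degree b"
        using field_long_division_theorem_shell[OF K(1) less.prems(1) bc(1)] bc(2)
        by (auto simp: univ_poly_zero)
      have ev: "eval p y = eval b y \<otimes> eval q y \<oplus> eval r y"
        using p q r bc(1) by simp
      have bq: "eval b y \<otimes> eval q y \<in> vmax" using vmax_mult_right[OF bc(3) eval_V[OF q]] .
      have pow0: "u = eval b y [^] (0::nat) \<otimes> u" if "u \<in> vunits" for u
        using vunits_nz[OF that] by simp
      show ?case
      proof (cases "r = []")
        case False
        then have "length r < length b" using deg by (cases r; cases b) auto
        then have "r \<notin> S" using least[of r] by auto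
        then have "eval r y \<in> vunits" using False r eval_V[OF r] by (auto simp: S_def vmax_def)
        then have "eval p y \<in> vunits"
          using vunits_plus_vmax[OF _ bq] ev E.hom_closed[OF r] V_carrier vmax_V[OF bq]
          by (metis a_comm subset_iff)
        then show ?thesis using pow0 by metis
      next
        case True
        then have ev': "eval p y = eval b y \<otimes> eval q y"
          using ev E.hom_closed[OF bc(1)] E.hom_closed[OF q] by simp
        have qne: "q \<noteq> []" using ev' less.prems(2) E.hom_closed[OF bc(1)] by auto
        have "p = b \<otimes>\<^bsub>K[X]\<^esub> q"
          using p True bc(1) q E.R.r_zero[OF E.R.m_closed[OF bc(1) q]] by (simp add: univ_poly_zero)
        then have "degree p = degree b + degree q"
          using poly_mult_degree_eq[OF Kr bp, of q] q univ_poly_carrier bc(2) qne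
          by (auto simp: univ_poly_mult)
        moreover have "p \<noteq> []" using less.prems(2) by auto
        ultimately have "length q < length p" using deg_b qne by (cases p; cases q) auto
        moreover have "eval q y \<noteq> \<zero>" using ev' less.prems(2) E.hom_closed[OF bc(1)] by auto
        ultimately obtain k :: nat and u where u: "u \<in> vunits" "eval q y = eval b y [^] k \<otimes> u"
          using less.hyps q by blast
        have "eval p y = eval b y [^] Suc k \<otimes> u"
          using ev' u(2) vunits_nz[OF u(1)] E.hom_closed[OF bc(1)] by (simp add: m_ac)
        then show ?thesis using u(1) by blast
      qed
    qed
    then show ?thesis using bc(3) by blast
  qed
qed

text \<open>These are the elements whose value is an integer multiple of that of \<open>w\<close>.
  As modulus \<open>H\<close> they yield the equations \<open>z^N = w^k u\<close> that
  \<open>ex_uniformizer\<close> assumes.\<close>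

lemma subgroup_power_units:
  assumes w: "w \<in> carrier F - {\<zero>}"
  shows "subgroup {w [^] (k::int) \<otimes> u | k u. u \<in> vunits} (units_of F)" (is "subgroup ?H _")
proof (rule group.subgroupI[OF units_group])
  have nz: "w [^] (k::int) \<otimes> u \<in> carrier F - {\<zero>}" if "u \<in> vunits" for k u
    using mult_nz[OF int_pow_nz[OF w] vunits_nz[OF that]] .
  show "?H \<subseteq> carrier (units_of F)"
    unfolding units_of_carrier field_Units by (rule subsetI, elim CollectE exE conjE, simp only: nz)
  show "?H \<noteq> {}" using vunits_one by blast
  show "inv\<^bsub>units_of F\<^esub> a \<in> ?H" if aH: "a \<in> ?H" for a
  proof -
    obtain k :: int and u where u: "u \<in> vunits" "a = w [^] k \<otimes> u" using aH by blast
    have "inv\<^bsub>units_of F\<^esub> a = inv a"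
      using nz[OF u(1)] u(2) units_of_inv field_Units by metis
    also have "\<dots> = w [^] (- k) \<otimes> inv u"
      using u inv_mult_nz[OF int_pow_nz[OF w] vunits_nz[OF u(1)]] int_pow_minus[OF w] by simp
    finally show ?thesis using vunits_inv[OF u(1)] by blast
  qed
  show "a \<otimes>\<^bsub>units_of F\<^esub> a' \<in> ?H" if aH: "a \<in> ?H" "a' \<in> ?H" for a a'
  proof -
    obtain k l :: int and u u' where u: "u \<in> vunits" "a = w [^] k \<otimes> u"
      and u': "u' \<in> vunits" "a' = w [^] l \<otimes> u'" using aH by blast
    have c: "w [^] k \<in> carrier F" "w [^] l \<in> carrier F" "u \<in> carrier F" "u' \<in> carrier F"
      using int_pow_nz[OF w] u u' vunits_nz by blast+
    have "a \<otimes> a' = (w [^] k \<otimes> w [^] l) \<otimes> (u \<otimes> u')" unfolding u(2) u'(2) using c by algebra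
    then have "a \<otimes> a' = w [^] (k + l) \<otimes> (u \<otimes> u')" using int_pow_add[OF w] by simp
    then show ?thesis using vunits_mult[OF u(1) u'(1)] by (auto simp: units_of_mult)
  qed
qed

text \<open>The modulus for the case in which the valuation is trivial on
  \<open>K(y)\<close>.\<close>

lemma subgroup_vunits: "subgroup vunits (units_of F)"
proof (rule group.subgroupI[OF units_group])
  show "vunits \<subseteq> carrier (units_of F)"
    using vunits_nz unfolding units_of_carrier field_Units by blast
  show "vunits \<noteq> {}" using vunits_one by blast
  show "inv\<^bsub>units_of F\<^esub> a \<in> vunits" if "a \<in> vunits" for a
    using vunits_inv[OF that] vunits_nz[OF that] units_of_inv[of a] field_Units by simp
  show "a \<otimes>\<^bsub>units_of F\<^esub> b \<in> vunits" if "a \<in> vunits" "b \<in> vunits" for a b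
    using vunits_mult[OF that] by (simp add: units_of_mult)
qed

text \<open>With \<open>x\<close> one of \<open>y\<close>, \<open>1/y\<close> in \<open>V\<close>,
  the elements of \<open>K(y)\<close> are fractions over \<open>K[x]\<close>, and
  \<open>eval_eq_power_unit\<close> describes numerator and denominator. The second alternative is a
  valuation trivial on \<open>K(y)\<close>.\<close>

lemma generate_field_power_unit:
  assumes K: "subfield K F" "K \<subseteq> V" and y: "y \<in> carrier F"
  obtains w where "w \<in> vmax" "w \<noteq> \<zero>"
      "generate_field F (insert y K) - {\<zero>} \<subseteq> {w [^] (k::int) \<otimes> u | k u. u \<in> vunits}"
  | "generate_field F (insert y K) - {\<zero>} \<subseteq> vunits"
proof -
  obtain x where x: "x \<in> V" and yx: "y = x \<or> x \<noteq> \<zero> \<and> y = inv x"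
  proof (cases "y \<in> V")
    case False
    then have n: "y \<in> carrier F - {\<zero>}" using y V_closed(1) by auto
    show thesis using that[of "inv y"] V_total[OF n] False inv_nz[OF n] inv_cancel(3)[OF n] by auto
  qed (use that in blast)
  have xc: "x \<in> carrier F" using x V_carrier by blast
  have Kr: "subring K F" and Kc: "K \<subseteq> carrier F" using subfieldE[OF K(1)] by auto
  define A where "A = simple_extension K x"
  have A: "subring A F" using simple_extension_is_subring[OF Kr xc] A_def by simp
  have KA: "K \<subseteq> A" "x \<in> A"
    using simple_extension_incl[OF Kc xc] simple_extension_mem[OF Kr xc] A_def by auto
  have one: "\<one> \<in> A - {\<zero>}" using subringE(3)[OF A] by simp
  have incl: "\<exists>a \<in> A. \<exists>b \<in> A - {\<zero>}. h = a \<otimes> inv b" if "h \<in> insert y K" for h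
  proof (cases "h \<in> A")
    case True
    then have "h = h \<otimes> inv \<one>" using subringE(1)[OF A] by (auto simp: inv_one)
    then show ?thesis using True one by blast
  next
    case False
    \<comment> \<open>Only \<open>y = 1/x\<close> can fall outside \<open>A\<close>.\<close>
    then have "x \<noteq> \<zero>" "h = inv x" using that KA yx by auto
    then have "h = \<one> \<otimes> inv x" using inv_nz[of x] xc by simp
    then show ?thesis using one KA \<open>x \<noteq> \<zero>\<close> by blast
  qed
  have frac: "\<exists>a \<in> A - {\<zero>}. \<exists>b \<in> A - {\<zero>}. z = a \<otimes> inv b"
    if z: "z \<in> generate_field F (insert y K) - {\<zero>}" for z
  proof -
    obtain a b where ab: "a \<in> A" "b \<in> A - {\<zero>}" "z = a \<otimes> inv b"
      using generate_field_fraction[OF A incl] z by blast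
    have "inv b \<in> carrier F" using inv_nz[of b] ab(2) subringE(1)[OF A] by blast
    then have "a \<noteq> \<zero>" using z ab(3) by auto
    then show ?thesis using ab by blast
  qed
  obtain w where w: "w \<in> vmax"
    and rep: "\<forall>p \<in> carrier (K[X]). eval p x \<noteq> \<zero> \<longrightarrow> (\<exists>k::nat. \<exists>u \<in> vunits. eval p x = w [^] k \<otimes> u)"
    using eval_eq_power_unit[OF K x] by blast
  have A_rep: "\<exists>k::nat. \<exists>u \<in> vunits. a = w [^] k \<otimes> u" if "a \<in> A - {\<zero>}" for a
    using rep that simple_extension_as_eval_img[OF Kc xc] by (auto simp: A_def)
  show thesis
  proof (cases "w = \<zero>")
    case True
    \<comment> \<open>A positive power of 0 would make \<open>a\<close> zero, so the exponent is
      0.\<close>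
    have "a \<in> vunits" if a: "a \<in> A - {\<zero>}" for a
    proof -
      obtain k :: nat and u where u: "u \<in> vunits" "a = \<zero> [^] k \<otimes> u" using A_rep[OF a] True by blast
      then show ?thesis using a vunits_nz[OF u(1)] by (cases k) auto
    qed
    then have "generate_field F (insert y K) - {\<zero>} \<subseteq> vunits"
      using frac vunits_mult vunits_inv by blast
    then show thesis using that(2) by blast
  next
    case False
    then have wn: "w \<in> carrier F - {\<zero>}" using w V_carrier vmax_V by auto
    let ?H = "{w [^] (k::int) \<otimes> u | k u. u \<in> vunits}"
    note H = subgroup_units_of[OF subgroup_power_units[OF wn]]
    have "A - {\<zero>} \<subseteq> ?H"
    proof
      fix a assume "a \<in> A - {\<zero>}"
      then obtain k :: nat and u where "u \<in> vunits" "a = w [^] k \<otimes> u" using A_rep by blast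
      then have "a = w [^] int k \<otimes> u" by (simp add: int_pow_int)
      then show "a \<in> ?H" using \<open>u \<in> vunits\<close> by blast
    qed
    then have "generate_field F (insert y K) - {\<zero>} \<subseteq> ?H"
      using frac H(2)[OF _ H(3)] by blast
    then show thesis using that(1) w False by blast
  qed
qed

text \<open>Unless the valuation is trivial on \<open>K(y)\<close>, the values there are multiples
  of that of \<open>w\<close>, and finiteness of \<open>F\<close> over \<open>K(y)\<close> gives the
  common exponent \<open>N\<close> required by \<open>ex_uniformizer\<close>.\<close>

lemma ex_uniformizer_function_field:
  assumes K: "subfield K F" "K \<subseteq> V" and V: "V \<noteq> carrier F" and y: "y \<in> carrier F"
    and fin: "finite_dimension (generate_field F (insert y K)) (carrier F)"
  obtains t where "t \<in> vmax" "t \<noteq> \<zero>"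
    "\<And>z. z \<in> carrier F - {\<zero>} \<Longrightarrow> \<exists>n::int. \<exists>u \<in> vunits. z = t [^] n \<otimes> u"
proof -
  have "insert y K \<subseteq> carrier F" using y subfieldE(3)[OF K(1)] by blast
  then have L: "subfield (generate_field F (insert y K)) F" by (rule generate_field_is_subfield)
  from generate_field_power_unit[OF K y] show thesis
  proof cases
    case (1 w)
    have wn: "w \<in> carrier F - {\<zero>}" using 1 V_carrier vmax_V by auto
    have "vunits \<subseteq> {w [^] (k::int) \<otimes> u | k u. u \<in> vunits}"
    proof
      fix u assume u: "u \<in> vunits"
      then have "u = w [^] (0::int) \<otimes> u" using vunits_nz by simp
      then show "u \<in> {w [^] (k::int) \<otimes> u | k u. u \<in> vunits}" using u by blast
    qed
    from common_power_in_subgroup[OF L subgroup_power_units[OF wn] this 1(3) fin]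
    obtain N :: nat where "N > 0"
      "\<And>z. z \<in> carrier F - {\<zero>} \<Longrightarrow> z [^] N \<in> {w [^] (k::int) \<otimes> u | k u. u \<in> vunits}" by blast
    then show thesis using ex_uniformizer[OF 1(1,2), of N thesis] that by blast
  next
    case 2
    \<comment> \<open>Here every \<open>z^N\<close> would be a unit, but
      \<open>V \<noteq> carrier F\<close> supplies some \<open>z\<close> outside \<open>V\<close>,
      and the positive powers of \<open>inv z\<close> stay in \<open>vmax\<close>.\<close>
    obtain N :: nat where N: "N > 0" "\<And>z. z \<in> carrier F - {\<zero>} \<Longrightarrow> z [^] N \<in> vunits"
      using common_power_in_subgroup[OF L subgroup_vunits subset_refl 2 fin] by blast
    obtain z where z: "z \<in> carrier F" "z \<notin> V" using V V_carrier by blast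
    then have zn: "z \<in> carrier F - {\<zero>}" using V_closed(1) by auto
    then have "inv z \<in> vmax" using vmax_iff_inv[OF inv_nz[OF zn]] inv_cancel(3)[OF zn] z by simp
    then have "inv z [^] N \<in> vmax" using vmax_pow N(1) by blast
    then show thesis using N(2)[OF inv_nz[OF zn]] by (simp add: vmax_def)
  qed
qed

end


section \<open>Regular functions at a place\<close>

lemma (in field) int_pow_mult_distrib_nz:
  assumes "x \<in> carrier R - {\<zero>}" "y \<in> carrier R - {\<zero>}"
  shows "(x \<otimes> y) [^] (k::int) = x [^] k \<otimes> y [^] k"
  using comm_group.int_pow_distrib[OF units_comm_group, of x y k] mult_nz[OF assms] assms
  by (simp add: int_pow_units_of units_of_carrier units_of_mult field_Units)

context valued_field
begin

section \<open>The maximal ideal of the valuation ring and its generators\<close>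

lemma Units_V: "Units (F\<lparr>carrier := V\<rparr>) = vunits"
proof (rule subset_antisym)
  show "Units (F\<lparr>carrier := V\<rparr>) \<subseteq> vunits"
  proof
    fix u assume "u \<in> Units (F\<lparr>carrier := V\<rparr>)"
    then obtain x where x: "u \<in> V" "x \<in> V" "u \<otimes> x = \<one>" by (auto simp: Units_def)
    then have c: "u \<in> carrier F" "x \<in> carrier F" using V_carrier by auto
    have "inv u = x" using comm_inv_char[OF c x(3)] .
    moreover have "u \<noteq> \<zero>" using x(3) c(2) by auto
    ultimately show "u \<in> vunits" using x by (simp add: vunits_def)
  qed
  show "vunits \<subseteq> Units (F\<lparr>carrier := V\<rparr>)"
  proof
    fix u assume u: "u \<in> vunits"
    then show "u \<in> Units (F\<lparr>carrier := V\<rparr>)"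
      using vunits_V[OF u] vunits_V[OF vunits_inv[OF u]] inv_cancel[OF vunits_nz[OF u]]
      by (auto simp: Units_def)
  qed
qed

lemma ideal_vmax: "ideal vmax (F\<lparr>carrier := V\<rparr>)"
proof (rule idealI)
  show R: "ring (F\<lparr>carrier := V\<rparr>)" using subring_is_ring[OF V_subring] .
  \<comment> \<open>Negation in the restricted ring is defined by a description over
    \<open>V\<close>, so it has to be identified with that of \<open>F\<close>.\<close>
  have minus: "\<ominus>\<^bsub>F\<lparr>carrier := V\<rparr>\<^esub> a = \<ominus> a" if a: "a \<in> V" for a
  proof -
    have "a \<oplus> \<ominus> a = \<zero>" "\<ominus> a \<in> V" using a V_carrier V_closed(4) r_neg by auto
    then show ?thesis
      using abelian_group.minus_equality[OF ring.is_abelian_group[OF R], of "\<ominus> a" a] a V_carrier l_neg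
      by auto
  qed
  show "subgroup vmax (add_monoid (F\<lparr>carrier := V\<rparr>))"
  proof (rule group.subgroupI)
    show "group (add_monoid (F\<lparr>carrier := V\<rparr>))" using R by (rule abelian_group.a_group[OF ring.is_abelian_group])
    show "vmax \<subseteq> carrier (add_monoid (F\<lparr>carrier := V\<rparr>))" using vmax_V by auto
    show "vmax \<noteq> {}" using vmax_zero by blast
    show "inv\<^bsub>add_monoid (F\<lparr>carrier := V\<rparr>)\<^esub> a \<in> vmax" if "a \<in> vmax" for a
      using minus[OF vmax_V[OF that]] vmax_uminus[OF that] by (simp add: a_inv_def)
    show "a \<otimes>\<^bsub>add_monoid (F\<lparr>carrier := V\<rparr>)\<^esub> b \<in> vmax" if "a \<in> vmax" "b \<in> vmax" for a b
      using vmax_add[OF that] by simp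
  qed
qed (use vmax_mult vmax_mult_right in auto)

text \<open>A proper ideal contains no unit, so it lies in \<open>vmax\<close>; as
  \<open>vmax\<close> is itself a proper ideal, maximality forces equality.\<close>

lemma maximalideal_eq_vmax:
  assumes "maximalideal P (F\<lparr>carrier := V\<rparr>)"
  shows "P = vmax"
proof -
  interpret P: maximalideal P "F\<lparr>carrier := V\<rparr>" by fact
  have PV: "P \<subseteq> V" using P.a_subset by simp
  have "P \<subseteq> vmax"
  proof
    fix p assume p: "p \<in> P"
    show "p \<in> vmax"
    proof (rule ccontr)
      assume "p \<notin> vmax"
      then have u: "p \<in> vunits" using p PV by (auto simp: vmax_def)
      have "inv p \<otimes> p \<in> P" using P.I_l_closed[OF p] vunits_V[OF vunits_inv[OF u]] by simp
      then have one: "\<one> \<in> P" using inv_cancel(2)[OF vunits_nz[OF u]] by simp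
      have "x \<in> P" if "x \<in> V" for x
        using P.I_l_closed[OF one, of x] that V_carrier by auto
      then show False using P.I_notcarr PV by auto
    qed
  qed
  moreover have "vmax \<noteq> V" using vunits_one V_closed(2) by (auto simp: vmax_def)
  ultimately show ?thesis using P.I_maximal[OF ideal_vmax] vmax_V by auto
qed

text \<open>The right-hand side mentions only \<open>vmax\<close>, so a place determines its
  valuation ring, as the description in \<open>place_ring\<close> demands.\<close>

lemma V_eq: "V = {z \<in> carrier F. z = \<zero> \<or> inv z \<notin> vmax}"
proof -
  have "z \<in> V \<longleftrightarrow> inv z \<notin> vmax" if z: "z \<in> carrier F - {\<zero>}" for z
    using vmax_iff_inv[OF inv_nz[OF z]] inv_cancel(3)[OF z] by simp
  then show ?thesis using V_carrier V_closed(1) by auto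
qed

lemma vunits_int_pow: "u \<in> vunits \<Longrightarrow> u [^] (k::int) \<in> vunits"
  using subgroup_units_of(3,4)[OF subgroup_vunits] by (simp add: int_pow_def2 del: pow_nat)

text \<open>Each generator is a \<open>V\<close>-multiple of the other; cancelling \<open>t\<close>
  shows that the two factors are mutually inverse.\<close>

lemma generator_ratio:
  assumes t: "t \<in> V" "t \<noteq> \<zero>" and t': "t' \<in> V"
    and eq: "PIdl\<^bsub>F\<lparr>carrier := V\<rparr>\<^esub> t = PIdl\<^bsub>F\<lparr>carrier := V\<rparr>\<^esub> t'"
  obtains e where "e \<in> vunits" "t' = t \<otimes> e"
proof -
  have mem: "x \<in> PIdl\<^bsub>F\<lparr>carrier := V\<rparr>\<^esub> x" if "x \<in> V" for x
    using that V_closed(2) V_carrier by (force simp: cgenideal_def)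
  obtain x where x: "x \<in> V" "t' = x \<otimes> t"
    using mem[OF t'] eq by (auto simp: cgenideal_def)
  obtain y where y: "y \<in> V" "t = y \<otimes> t'"
    using mem[OF t(1)] eq by (auto simp: cgenideal_def)
  have c: "x \<in> carrier F" "y \<in> carrier F" "t \<in> carrier F" using x y t V_carrier by auto
  have "(x \<otimes> y) \<otimes> t = \<one> \<otimes> t" using x y c by (metis l_one m_assoc m_comm)
  then have "x \<otimes> y = \<one>" using m_rcancel[of t "x \<otimes> y" \<one>] c t(2) by simp
  then have "x \<in> Units (F\<lparr>carrier := V\<rparr>)"
    using x y c m_comm[of x y] by (auto simp: Units_def)
  then show thesis using that x c m_comm by (simp add: Units_V)
qed

text \<open>In \<open>z = t^n u\<close> a nonunit has \<open>n > 0\<close>, so one factor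
  \<open>t\<close> splits off with cofactor \<open>t^(n-1) u\<close> in \<open>V\<close>.\<close>

lemma uniformizer_generates:
  assumes t: "t \<in> vmax" "t \<noteq> \<zero>"
    and rep: "\<And>z. z \<in> carrier F - {\<zero>} \<Longrightarrow> \<exists>n::int. \<exists>u \<in> vunits. z = t [^] n \<otimes> u"
  shows "vmax = PIdl\<^bsub>F\<lparr>carrier := V\<rparr>\<^esub> t"
proof (rule subset_antisym)
  have tn: "t \<in> carrier F - {\<zero>}" using t V_carrier vmax_V by auto
  show "PIdl\<^bsub>F\<lparr>carrier := V\<rparr>\<^esub> t \<subseteq> vmax"
    using vmax_mult[OF _ t(1)] by (auto simp: cgenideal_def)
  show "vmax \<subseteq> PIdl\<^bsub>F\<lparr>carrier := V\<rparr>\<^esub> t"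
  proof
    fix z assume z: "z \<in> vmax"
    show "z \<in> PIdl\<^bsub>F\<lparr>carrier := V\<rparr>\<^esub> t"
    proof (cases "z = \<zero>")
      case True
      then have "z = \<zero> \<otimes> t" using tn by simp
      then show ?thesis using V_closed(1) by (auto simp: cgenideal_def)
    next
      case False
      then have zn: "z \<in> carrier F - {\<zero>}" using z V_carrier vmax_V by auto
      obtain n :: int and u where u: "u \<in> vunits" "z = t [^] n \<otimes> u" using rep[OF zn] by blast
      have c: "t [^] (k::int) \<in> carrier F" "u \<in> carrier F" "t \<in> carrier F" for k
        using int_pow_nz[OF tn] u vunits_nz tn by blast+
      have pow_V: "t [^] (k::int) \<in> V" if "k \<ge> 0" for k
        using int_pow_vmax[OF t(1), of k] that vmax_V V_closed(2) by (cases "k = 0") auto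
      \<comment> \<open>For \<open>n \<le> 0\<close> the product \<open>t^(-n) z\<close> would stay
        in \<open>vmax\<close>, yet it equals the unit \<open>u\<close>.\<close>
      have "n > 0"
      proof (rule ccontr)
        assume "\<not> n > 0"
        then have "t [^] (-n) \<otimes> z \<in> vmax" using vmax_mult[OF pow_V z] by simp
        moreover have "t [^] (-n) \<otimes> z = (t [^] (-n) \<otimes> t [^] n) \<otimes> u"
          using u(2) c by (simp add: m_assoc)
        moreover have "t [^] (-n) \<otimes> t [^] n = \<one>" using int_pow_add[OF tn, of "-n" n] by simp
        ultimately show False using u(1) c by (simp add: vmax_def)
      qed
      have "t [^] n = t [^] (n - 1) \<otimes> t"
        using int_pow_add[OF tn, of "n - 1" 1] int_pow_int[of F t 1] c by simp
      then have "z = (t [^] (n - 1) \<otimes> u) \<otimes> t" using u(2) c by (simp add: m_ac)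
      moreover have "t [^] (n - 1) \<otimes> u \<in> V" using V_closed(5)[OF pow_V vunits_V[OF u(1)]] \<open>n > 0\<close> by simp
      ultimately show ?thesis by (auto simp: cgenideal_def)
    qed
  qed
qed

text \<open>Two generators differ by a unit \<open>e\<close>, and
  \<open>t'^m u' = t^m (e^m u')\<close> reduces the claim to a single base. Hence
  \<open>place_val\<close> does not depend on the prime element.\<close>

lemma exponent_unique:
  assumes t: "t \<in> V" "vmax = PIdl\<^bsub>F\<lparr>carrier := V\<rparr>\<^esub> t" and t': "t' \<in> V" "vmax = PIdl\<^bsub>F\<lparr>carrier := V\<rparr>\<^esub> t'"
    and "t \<noteq> \<zero>" and u: "u \<in> vunits" "u' \<in> vunits"
    and eq: "t [^] (n::int) \<otimes> u = t' [^] (m::int) \<otimes> u'"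
  shows "n = m"
proof -
  have tn: "t \<in> carrier F - {\<zero>}" using assms V_carrier by auto
  have tm: "t \<in> vmax" using t V_closed(2) tn by (force simp: cgenideal_def)
  obtain e where e: "e \<in> vunits" "t' = t \<otimes> e"
    using generator_ratio[OF t(1) \<open>t \<noteq> \<zero>\<close> t'(1)] t(2) t'(2) by metis
  have c: "t [^] m \<in> carrier F" "e [^] m \<in> carrier F" "u' \<in> carrier F"
    using int_pow_nz tn vunits_nz e(1) u(2) by blast+
  have "t' [^] m \<otimes> u' = t [^] m \<otimes> (e [^] m \<otimes> u')"
    using int_pow_mult_distrib_nz[OF tn vunits_nz[OF e(1)]] e(2) c by (simp add: m_assoc)
  then show ?thesis
    using int_pow_unit_unique[OF tm \<open>t \<noteq> \<zero>\<close> u(1) vunits_mult[OF vunits_int_pow[OF e(1)] u(2)]] eq by metis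
qed

end

text \<open>A place is the set of nonunits of its ring, and \<open>V_eq\<close> recovers the ring
  from it; this evaluates the description in \<open>place_ring\<close> and gives access to
  \<open>valued_field\<close>.\<close>

lemma places_cases:
  assumes "field F" "P \<in> places F K"
  obtains V where "valued_field F V" "K \<subset> V" "V \<subset> carrier F" "place_ring F K P = F\<lparr>carrier := V\<rparr>"
    "P = valued_field.vmax F V" "maximalideal P (F\<lparr>carrier := V\<rparr>)"
proof -
  have vf: "valued_field F V" if "valuation_ring F K V" for V
    using that assms(1) by (auto simp: valued_field_def valued_field_axioms_def valuation_ring_def)
  obtain V where V: "valuation_ring F K V" "maximalideal P (F\<lparr>carrier := V\<rparr>)"
    using assms(2) by (auto simp: places_def)
  have P: "P = valued_field.vmax F V" using valued_field.maximalideal_eq_vmax[OF vf] V by blast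
  have "(THE V. valuation_ring F K V \<and> maximalideal P (F\<lparr>carrier := V\<rparr>)) = V"
  proof (rule the_equality)
    fix V' assume V': "valuation_ring F K V' \<and> maximalideal P (F\<lparr>carrier := V'\<rparr>)"
    then have "P = valued_field.vmax F V'" using valued_field.maximalideal_eq_vmax[OF vf] by blast
    then show "V' = V"
      using valued_field.V_eq[OF vf] V V' P by metis
  qed (use V in blast)
  then have "place_ring F K P = F\<lparr>carrier := V\<rparr>" by (simp add: place_ring_def)
  then show thesis using that[of V] vf V P by (simp add: valuation_ring_def)
qed

text \<open>The description in \<open>place_val\<close> is informative only once a prime element
  exists. With the uniformizer \<open>t\<close> it evaluates to the exponent \<open>n\<close> in
  \<open>f = t^n u\<close>, and \<open>n \<ge> 0\<close> puts \<open>f\<close> in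
  \<open>V\<close>.\<close>

lemma nonneg_place_val_imp_regular:
  fixes F (structure)
  assumes FF: "function_field F K" and P: "P \<in> places F K"
    and f: "f \<in> carrier F" "f \<noteq> \<zero>\<^bsub>F\<^esub>" "place_val F K P f \<ge> 0"
  shows "f \<in> carrier (place_ring F K P)"
proof -
  have field: "field F" and K: "subfield K F" using FF by (auto simp: function_field_def)
  obtain V where V: "valued_field F V" "K \<subset> V" "V \<subset> carrier F" "place_ring F K P = F\<lparr>carrier := V\<rparr>"
    "P = valued_field.vmax F V"
    using places_cases[OF field P] by metis
  interpret valued_field F V by fact
  obtain y where y: "y \<in> carrier F" "finite_dimension (generate_field F (insert y K)) (carrier F)"
    using FF by (auto simp: function_field_def)
  obtain t where t: "t \<in> vmax" "t \<noteq> \<zero>"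
    and rep: "\<And>z. z \<in> carrier F - {\<zero>} \<Longrightarrow> \<exists>n::int. \<exists>u \<in> vunits. z = t [^] n \<otimes> u"
    using ex_uniformizer_function_field[OF K _ _ y] V(2,3) by (metis psubset_imp_subset psubset_eq)
  have gen: "vmax = PIdl\<^bsub>F\<lparr>carrier := V\<rparr>\<^esub> t" using uniformizer_generates[OF t rep] .
  obtain n :: int and u where u: "u \<in> vunits" "f = t [^] n \<otimes> u" using rep[of f] f by blast
  have "place_val F K P f = n"
    unfolding place_val_def
  proof (rule the_equality)
    show "\<exists>t u. t \<in> carrier (place_ring F K P) \<and> P = PIdl\<^bsub>place_ring F K P\<^esub> t \<and>
        u \<in> Units (place_ring F K P) \<and> f = t [^] n \<otimes> u"
      unfolding V(4) unfolding V(5) Units_V using vmax_V[OF t(1)] gen u by auto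
    fix m :: int assume "\<exists>t u. t \<in> carrier (place_ring F K P) \<and> P = PIdl\<^bsub>place_ring F K P\<^esub> t \<and>
        u \<in> Units (place_ring F K P) \<and> f = t [^] m \<otimes> u"
    then obtain t' u' where "t' \<in> V" "vmax = PIdl\<^bsub>F\<lparr>carrier := V\<rparr>\<^esub> t'" "u' \<in> vunits" "f = t' [^] m \<otimes> u'"
      unfolding V(4) unfolding V(5) Units_V by auto
    then show "m = n" using exponent_unique[OF vmax_V[OF t(1)] gen _ _ t(2) u(1)] u(2) by metis
  qed
  then have "n \<ge> 0" using f(3) by simp
  then have "t [^] n \<in> V"
    using int_pow_vmax[OF t(1), of n] vmax_V V_closed(2) by (cases "n = 0") auto
  then have "f \<in> V" using V_closed(5) vunits_V u by blast
  then show ?thesis using V(4) by simp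
qed

text \<open>Since \<open>G P = 0\<close>, a nonzero \<open>f\<close> has value at least 0 at
  \<open>P\<close>, so it lies in the valuation ring and its coset belongs to the quotient.\<close>

lemma eval_at_riemann_roch:
  fixes F (structure)
  assumes FF: "function_field F K" and P: "P \<in> places F K" and G: "G P = 0"
    and f: "f \<in> riemann_roch F K G"
  shows "eval_at F K P f \<in> carrier (residue_field F K P)"
proof -
  have field: "field F" using FF by (auto simp: function_field_def)
  obtain V where V: "valued_field F V" "place_ring F K P = F\<lparr>carrier := V\<rparr>"
    and max: "maximalideal P (F\<lparr>carrier := V\<rparr>)"
    using places_cases[OF field P] by metis
  interpret valued_field F V by fact
  interpret P: maximalideal P "F\<lparr>carrier := V\<rparr>" by fact
  have "f \<in> V"
  \<comment> \<open>The zero function is treated apart, because \<open>place_val\<close> has no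
    meaning there.\<close>
  proof (cases "f = \<zero>")
    case True
    then show ?thesis using V_closed(1) by simp
  next
    case False
    then have "f \<in> carrier F" "place_val F K P f \<ge> 0" using f P G by (auto simp: riemann_roch_def)
    then show ?thesis using nonneg_place_val_imp_regular[OF FF P _ False] V(2) by simp
  qed
  then have "P +>\<^bsub>F\<lparr>carrier := V\<rparr>\<^esub> f \<in> a_rcosets\<^bsub>F\<lparr>carrier := V\<rparr>\<^esub> P"
    using P.a_rcosetsI[OF P.a_subset, of f] by simp
  then show ?thesis unfolding residue_field_def eval_at_def FactRing_def V(2) by simp
qed


section \<open>Locality of concatenated codes\<close>

lemma has_locality_mono:
  assumes "has_locality n D l" "C \<subseteq> D" "l \<le> r"
  shows "has_locality n C r"
  unfolding has_locality_def
proof (intro allI impI)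
  fix i assume "i < n"
  then obtain N where "N \<subseteq> {..<n} - {i}" "card N \<le> l"
    "\<forall>c \<in> D. \<forall>c' \<in> D. (\<forall>j \<in> N. c ! j = c' ! j) \<longrightarrow> c ! i = c' ! i"
    using assms(1) unfolding has_locality_def by meson
  then show "\<exists>N \<subseteq> {..<n} - {i}. card N \<le> r \<and>
      (\<forall>c \<in> C. \<forall>c' \<in> C. (\<forall>j \<in> N. c ! j = c' ! j) \<longrightarrow> c ! i = c' ! i)"
    using assms(2,3) by (intro exI[of _ N]) (auto simp: subset_iff)
qed

text \<open>Recovery sets stay inside their block: unchanged in the first, shifted by
  \<open>n\<close> in the second. The common length of the words of \<open>C\<close> fixes the
  boundary.\<close>

lemma has_locality_append:
  assumes C: "has_locality n C r" "\<And>c. c \<in> C \<Longrightarrow> length c = n"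
    and D: "has_locality m D r"
  shows "has_locality (n + m) {c @ d | c d. c \<in> C \<and> d \<in> D} r"
  unfolding has_locality_def
proof (intro allI impI)
  let ?E = "{c @ d | c d. c \<in> C \<and> d \<in> D}"
  fix i assume i: "i < n + m"
  show "\<exists>N \<subseteq> {..<n + m} - {i}. card N \<le> r \<and>
      (\<forall>c \<in> ?E. \<forall>c' \<in> ?E. (\<forall>j \<in> N. c ! j = c' ! j) \<longrightarrow> c ! i = c' ! i)"
  proof (cases "i < n")
    case True
    then obtain N where N: "N \<subseteq> {..<n} - {i}" "card N \<le> r"
      "\<forall>c \<in> C. \<forall>c' \<in> C. (\<forall>j \<in> N. c ! j = c' ! j) \<longrightarrow> c ! i = c' ! i"
      using C(1) unfolding has_locality_def by meson
    have nth: "(c @ d) ! j = c ! j" if "c \<in> C" "j \<in> insert i N" for c d j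
      using that N(1) True C(2) by (auto simp: nth_append)
    have "(c @ d) ! i = (c' @ d') ! i"
      if "c \<in> C" "c' \<in> C" "\<forall>j \<in> N. (c @ d) ! j = (c' @ d') ! j" for c c' d d'
    proof -
      have "\<forall>j \<in> N. c ! j = c' ! j" using that(3) nth[OF that(1)] nth[OF that(2)] by simp
      then have "c ! i = c' ! i" using N(3) that(1,2) by blast
      then show ?thesis using nth[OF that(1)] nth[OF that(2)] by simp
    qed
    moreover have "N \<subseteq> {..<n + m} - {i}" using N(1) by auto
    ultimately show ?thesis using N(2) by (intro exI[of _ N]) blast
  next
    case False
    then have "i - n < m" using i by simp
    then obtain N where N: "N \<subseteq> {..<m} - {i - n}" "card N \<le> r"
      "\<forall>c \<in> D. \<forall>c' \<in> D. (\<forall>j \<in> N. c ! j = c' ! j) \<longrightarrow> c ! (i - n) = c' ! (i - n)"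
      using D unfolding has_locality_def by meson
    have nth: "(c @ d) ! (n + j) = d ! j" if "c \<in> C" for c d j
      using C(2)[OF that] by (simp add: nth_append)
    have "(c @ d) ! i = (c' @ d') ! i"
      if "c \<in> C" "c' \<in> C" "d \<in> D" "d' \<in> D" "\<forall>j \<in> (+) n ` N. (c @ d) ! j = (c' @ d') ! j" for c c' d d'
    proof -
      have "\<forall>j \<in> N. d ! j = d' ! j" using that(5) nth[OF that(1)] nth[OF that(2)] by simp
      then have "d ! (i - n) = d' ! (i - n)" using N(3) that(3,4) by blast
      then show ?thesis
        using nth[OF that(1), of d "i - n"] nth[OF that(2), of d' "i - n"] False by simp
    qed
    moreover have "(+) n ` N \<subseteq> {..<n + m} - {i}" using N(1) False by auto
    moreover have "card ((+) n ` N) \<le> r" using N(2) by (simp add: card_image)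
    ultimately show ?thesis by (intro exI[of _ "(+) n ` N"]) blast
  qed
qed

text \<open>The blocks vary independently here, so the code is an iterated concatenation and
  induction on \<open>s\<close> splits off the last block.\<close>

lemma has_locality_concat:
  assumes "\<And>i. i \<in> {1..s} \<Longrightarrow> has_locality (n i) (C i) r"
    and "\<And>i c. i \<in> {1..s} \<Longrightarrow> c \<in> C i \<Longrightarrow> length c = n i"
  shows "has_locality (\<Sum>i = 1..s. n i) {concat (map c [1..<Suc s]) | c. \<forall>i \<in> {1..s}. c i \<in> C i} r"
  using assms
proof (induction s)
  case 0
  \<comment> \<open>A code of length 0 has no position to recover.\<close>
  then show ?case by (simp add: has_locality_def)
next
  case (Suc s)
  let ?E = "\<lambda>s. {concat (map c [1..<Suc s]) | c. \<forall>i \<in> {1..s}. c i \<in> C i}"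
  have len: "length w = (\<Sum>i = 1..s. n i)" if w: "w \<in> ?E s" for w
  proof -
    obtain c where c: "w = concat (map c [1..<Suc s])" "\<forall>i \<in> {1..s}. c i \<in> C i" using w by blast
    have "length w = (\<Sum>i = 1..s. length (c i))"
      unfolding c(1) length_concat map_map comp_def
      by (simp add: interv_sum_list_conv_sum_set_nat atLeastLessThanSuc_atLeastAtMost del: upt_Suc)
    also have "\<dots> = (\<Sum>i = 1..s. n i)"
      using c(2) Suc.prems(2) by (intro sum.cong) auto
    finally show ?thesis .
  qed
  have "has_locality (\<Sum>i = 1..s. n i) (?E s) r" using Suc by simp
  moreover have "has_locality (n (Suc s)) (C (Suc s)) r" using Suc.prems(1) by simp
  ultimately have "has_locality ((\<Sum>i = 1..s. n i) + n (Suc s)) {c @ d | c d. c \<in> ?E s \<and> d \<in> C (Suc s)} r"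
    using has_locality_append len by blast
  moreover have "?E (Suc s) \<subseteq> {c @ d | c d. c \<in> ?E s \<and> d \<in> C (Suc s)}"
  proof
    fix w assume "w \<in> ?E (Suc s)"
    then obtain c where c: "w = concat (map c [1..<Suc (Suc s)])" "\<forall>i \<in> {1..Suc s}. c i \<in> C i" by blast
    then have "w = concat (map c [1..<Suc s]) @ c (Suc s)" by simp
    moreover have "concat (map c [1..<Suc s]) \<in> ?E s"
      using c(2) by (intro CollectI exI conjI) auto
    moreover have "c (Suc s) \<in> C (Suc s)" using c(2) by simp
    ultimately show "w \<in> {c @ d | c d. c \<in> ?E s \<and> d \<in> C (Suc s)}"
      by blast
  qed
  ultimately show ?case using has_locality_mono[of _ _ r _ r] by (simp del: upt_Suc)
qed

theorem proposition4p1: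
  fixes F :: "('a, 'm) ring_scheme"
    and K :: "'a set"
    and q g s r :: nat
    and P :: "nat \<Rightarrow> 'a set"
    and G :: "'a set \<Rightarrow> int"
    and n k d :: "nat \<Rightarrow> nat"
    and C :: "nat \<Rightarrow> 'a list set"
    and \<pi> :: "nat \<Rightarrow> 'a set \<Rightarrow> 'a list"
  assumes "function_field F K" and "finite K" and "card K = q"
    and "genus F K = int g"
    and "\<And>i. i \<in> {1..s} \<Longrightarrow> P i \<in> places F K"
    and "inj_on P {1..s}"
    and "\<And>i. i \<in> {1..s} \<Longrightarrow> k i = place_degree F K (P i)"
    and "G \<in> divisors F K"
    and "supp G \<inter> P ` {1..s} = {}"
    and "divisor_degree F K G < (\<Sum>i = 1..s. int (k i))"
    and "\<And>i. i \<in> {1..s} \<Longrightarrow> nkd_code F K (n i) (k i) (d i) (C i)"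
    and "\<And>i. i \<in> {1..s} \<Longrightarrow> \<exists>l \<le> k i. has_locality (n i) (C i) l"
    and "\<And>i. i \<in> {1..s} \<Longrightarrow> residue_iso F K (P i) (C i) (\<pi> i)"
    and "\<And>i. i \<in> {1..s} \<Longrightarrow> 1 < k i \<and> k i \<le> r \<and> place_degree F K (P i) < n i"
  shows "has_locality (\<Sum>i = 1..s. n i) (gag_code F K s P G \<pi>) r"
proof -
  have "\<pi> i (eval_at F K (P i) f) \<in> C i" if i: "i \<in> {1..s}" and f: "f \<in> riemann_roch F K G" for i f
  proof -
    \<comment> \<open>\<open>P i\<close> lies outside the support of \<open>G\<close>, so
      \<open>f\<close> is regular there and \<open>\<pi> i\<close> is applied within its
      domain.\<close>
    have "G (P i) = 0" using assms(9) i by (auto simp: supp_def)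
    then have "eval_at F K (P i) f \<in> carrier (residue_field F K (P i))"
      using eval_at_riemann_roch[OF assms(1) assms(5)[OF i] _ f] by blast
    then show ?thesis using assms(13)[OF i] by (auto simp: residue_iso_def bij_betw_def)
  qed
  \<comment> \<open>Forgetting that all blocks come from one function \<open>f\<close> only enlarges
    the code, and locality passes down to subcodes.\<close>
  then have "gag_code F K s P G \<pi> \<subseteq> {concat (map c [1..<Suc s]) | c. \<forall>i \<in> {1..s}. c i \<in> C i}"
    unfolding gag_code_def by blast
  moreover have "has_locality (n i) (C i) r" if i: "i \<in> {1..s}" for i
    using assms(12)[OF i] assms(14)[OF i] has_locality_mono[of "n i" "C i" _ "C i" r]
    by (meson order_refl order_trans)
  moreover have "length c = n i" if "i \<in> {1..s}" "c \<in> C i" for i c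
    using assms(11)[OF that(1)] that(2) by (auto simp: nkd_code_def linear_code_def words_def)
  ultimately show ?thesis using has_locality_mono[OF has_locality_concat] by blast
qed

end
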